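(* For each $n\in\mathbb{N}$ let $G=G_n$ be a simple graph on $[n]$ and let $d=d_n$ be a positive integer. Suppose that, as $n\to\infty$, \[ d \ll \mathsf{num}_G(C_3),\qquad \mathsf{num}_G(C_3^{2,e})+\mathsf{num}_G(C_3^{2,v}) \ll \mathsf{num}_G(C_3)^2 . \] Then $\mathsf{TV}(\kappa_3(W(G,d)),\kappa_3(M(G)))\to 1$ as $n\to\infty$. In particular, $\mathsf{TV}(W(G,d),M(G))\to 1$.
   Context: Masked Wishart law: for a graph $G$ on $[n]$ with adjacency matrix $A_G$, $W(G,d)$ is the law of $A_G\odot \bigl(d^{-1/2}(X^\top X-dI_n)\bigr)$, where $X\in\mathbb{R}^{d\times n}$ has i.i.d. standard Gaussian entries and $\odot$ is the entrywise (Schur) product. Masked GOE law: $M(G)$ is the law of $A_G\odot M$, where $M$ is an $n\times n$ GOE matrix, i.e. a symmetric matrix with standard Gaussian off-diagonal entries, $\mathcal N(0,2)$ diagonal entries, and mutually independent entries on or above the diagonal. $\mathsf{TV}$ is total variation distance. Statistic: $C_3(G)=\{(i,j,k): (i,j),(j,k),(k,i)\in E(G),\ i<j<k\}$ and $\kappa_3:\mathbb{R}^{n\times n}\to\mathbb{R}$ is $\kappa_3(M)=\sum_{(i,j,k)\in C_3(G)}M_{i,j}M_{j,k}M_{k,i}$. For a law $\mu$ on $\mathbb{R}^{n\times n}$, $\kappa_3(\mu)$ denotes the law of $\kappa_3(M)$ for $M\sim\mu$. Subgraph counts: for a fixed graph $H$, $\mathsf{num}_G(H)$ is the number of (not necessarily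 induced) subgraphs of $G$ isomorphic to $H$. $C_3$ is the triangle; $C_3^{2,e}$ is the graph on 4 vertices and 5 edges formed by two triangles sharing exactly one edge; $C_3^{2,v}$ is the graph on 5 vertices and 6 edges formed by two triangles sharing exactly one vertex. Asymptotics: $f(n)\ll g(n)$ means $\lim_{n\to\infty} g(n)/f(n)=\infty$ (with $g/0=+\infty$ for $g>0$). *)

theory Defs
  imports "HOL-Probability.Probability"
begin

section \<open>Graphs and subgraph counts\<close>

type_synonym 'a graph = "'a set \<times> 'a set set"

abbreviation verts :: "'a graph \<Rightarrow> 'a set" where "verts \<equiv> fst"
abbreviation edges :: "'a graph \<Rightarrow> 'a set set" where "edges \<equiv> snd"

definition simple_graph :: "'a graph \<Rightarrow> bool" where
  "simple_graph G \<longleftrightarrow> finite (verts G) \<and> (\<forall>e\<in>edges G. e \<subseteq> verts G \<and> card e = 2)"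

definition is_subgraph :: "'a graph \<Rightarrow> 'a graph \<Rightarrow> bool" where
  "is_subgraph S G \<longleftrightarrow> simple_graph S \<and> verts S \<subseteq> verts G \<and> edges S \<subseteq> edges G"

definition graph_iso :: "'a graph \<Rightarrow> 'b graph \<Rightarrow> bool" where
  "graph_iso S H \<longleftrightarrow>
     (\<exists>f. bij_betw f (verts S) (verts H) \<and> edges H = (\<lambda>e. f ` e) ` edges S)"

definition num_subgraphs :: "'a graph \<Rightarrow> 'b graph \<Rightarrow> nat" where
  "num_subgraphs G H = card {S. is_subgraph S G \<and> graph_iso S H}"

definition triangle_graph :: "nat graph" where
  "triangle_graph = ({1, 2, 3}, {{1, 2}, {2, 3}, {1, 3}})"

text \<open>Two triangles sharing exactly one edge, resp. exactly one vertex.\<close>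

definition triangles_edge :: "nat graph" where
  "triangles_edge = ({1, 2, 3, 4}, {{1, 2}, {2, 3}, {1, 3}, {2, 4}, {3, 4}})"

definition triangles_vertex :: "nat graph" where
  "triangles_vertex =
     ({1, 2, 3, 4, 5}, {{1, 2}, {2, 3}, {1, 3}, {1, 4}, {4, 5}, {1, 5}})"


section \<open>Laws of random matrices\<close>

text \<open>
  A real matrix of size $m \times n$ is an extensional function on
  $\{1..m\} \times \{1..n\}$, because the size varies with the index of the sequence.
\<close>

type_synonym matrix = "nat \<times> nat \<Rightarrow> real"

definition matrix_space :: "nat \<Rightarrow> matrix measure" where
  "matrix_space n = Pi\<^sub>M ({1..n} \<times> {1..n}) (\<lambda>_. borel)"

text \<open>The second argument is the variance; \<open>normal_density\<close> takes the standard deviation.\<close>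

definition gaussian :: "real \<Rightarrow> real \<Rightarrow> real measure" where
  "gaussian m v = density lborel (normal_density m (sqrt v))"

definition gaussian_matrix :: "nat \<Rightarrow> nat \<Rightarrow> matrix measure" where
  "gaussian_matrix d n = Pi\<^sub>M ({1..d} \<times> {1..n}) (\<lambda>_. gaussian 0 1)"

text \<open>The law of $d^{-1/2} (X^\top X - d I_n)$ for $X$ with law \<open>gaussian_matrix d n\<close>.\<close>

definition wishart :: "nat \<Rightarrow> nat \<Rightarrow> matrix measure" where
  "wishart n d = distr (gaussian_matrix d n) (matrix_space n)
     (\<lambda>X. \<lambda>(i, j)\<in>{1..n} \<times> {1..n}.
        ((\<Sum>k=1..d. X (k, i) * X (k, j)) - real d * (if i = j then 1 else 0)) / sqrt (real d))"

text \<open>The independent entries on or above the diagonal are drawn first and then reflected.\<close>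

definition goe :: "nat \<Rightarrow> matrix measure" where
  "goe n = distr
     (Pi\<^sub>M {(i, j). 1 \<le> i \<and> i \<le> j \<and> j \<le> n} (\<lambda>(i, j). gaussian 0 (if i = j then 2 else 1)))
     (matrix_space n)
     (\<lambda>Y. \<lambda>(i, j)\<in>{1..n} \<times> {1..n}. Y (min i j, max i j))"

definition adjacency :: "nat graph \<Rightarrow> matrix" where
  "adjacency G = (\<lambda>(i, j). if {i, j} \<in> edges G then 1 else 0)"

definition schur_product :: "nat \<Rightarrow> matrix \<Rightarrow> matrix \<Rightarrow> matrix" where
  "schur_product n A B = (\<lambda>p\<in>{1..n} \<times> {1..n}. A p * B p)"

definition masked :: "nat \<Rightarrow> nat graph \<Rightarrow> matrix measure \<Rightarrow> matrix measure" where
  "masked n G \<mu> = distr \<mu> (matrix_space n) (schur_product n (adjacency G))"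

definition masked_wishart :: "nat \<Rightarrow> nat graph \<Rightarrow> nat \<Rightarrow> matrix measure" where
  "masked_wishart n G d = masked n G (wishart n d)"

definition masked_goe :: "nat \<Rightarrow> nat graph \<Rightarrow> matrix measure" where
  "masked_goe n G = masked n G (goe n)"


section \<open>The triangle statistic and total variation\<close>

definition C3 :: "nat graph \<Rightarrow> (nat \<times> nat \<times> nat) set" where
  "C3 G = {(i, j, k). {i, j} \<in> edges G \<and> {j, k} \<in> edges G \<and> {k, i} \<in> edges G \<and> i < j \<and> j < k}"

definition kappa3 :: "nat graph \<Rightarrow> matrix \<Rightarrow> real" where
  "kappa3 G M = (\<Sum>(i, j, k)\<in>C3 G. M (i, j) * M (j, k) * M (k, i))"

definition kappa3_law :: "nat graph \<Rightarrow> matrix measure \<Rightarrow> real measure" where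
  "kappa3_law G \<mu> = distr \<mu> borel (kappa3 G)"

text \<open>Meant for probability measures on the same \<open>\<sigma>\<close>-algebra.\<close>

definition total_variation :: "'a measure \<Rightarrow> 'a measure \<Rightarrow> real" where
  "total_variation \<mu> \<nu> = (SUP A\<in>sets \<mu>. \<bar>measure \<mu> A - measure \<nu> A\<bar>)"

text \<open>
  \<open>f \<lless> g\<close> means $g/f \to \infty$. Division is in \<open>ereal\<close>, where \<open>x / 0 = \<infinity>\<close> for
  \<open>x > 0\<close> (and \<open>0 / 0 = 0\<close>). Meant for nonnegative sequences.
\<close>

definition much_less :: "(nat \<Rightarrow> real) \<Rightarrow> (nat \<Rightarrow> real) \<Rightarrow> bool" (infix "\<lless>" 50) where
  "f \<lless> g \<longleftrightarrow> (\<lambda>n. ereal (g n) / ereal (f n)) \<longlonglongrightarrow> \<infinity>"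

end

theory Submission
  imports Defs
begin

text \<open>
  The statistic \<open>kappa3\<close> detects a feature of a Wishart matrix that a matrix with independent entries lacks:
  its triangles are biased. If \<open>i\<close>, \<open>j\<close>, \<open>k\<close> are distinct, then averaging out one Gaussian column at a
  time gives $E (W_{ij} W_{jk} W_{ki}) = d^{-1/2}$, whereas the same product has mean zero under the
  GOE. With $T$ triangles in the graph, the two means of \<open>kappa3\<close> differ by $T / \sqrt d$, and
  Chebyshev's inequality at the midpoint $T / (2 \sqrt d)$ separates the two laws once both variances
  are small compared with $T^2 / d$.

  Under the GOE, products over distinct triangles are orthogonal, because some edge lies in just one of
  the two triangles and its entry is centred. So the second moment is exactly $T$, and
  $T \ll T^2 / d$ is the first hypothesis (\<open>second_moment_edge_triangles\<close>).

  Under the Wishart law, the covariance of two triangle products depends only on the number of shared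
  vertices. With the unnormalised Gram matrix $X^\top X$, it is of order $d^3$ for equal triangles,
  $d^2$ for a shared edge, $d$ for a single shared vertex, and $0$ for disjoint triangles
  (\<open>expectation_triangle_products_le\<close>). After division by $d^3$ this bounds the variance by
  $27 T + 9 P / d$, where $P$ counts the ordered pairs of distinct triangles that meet
  (\<open>variance_triangle_sum_le\<close>). The union of such a pair is a copy of \<open>triangles_edge\<close> or of
  \<open>triangles_vertex\<close>, so $P$ is at most a constant times the number of these copies
  (\<open>card_overlapping_pairs_le\<close>), and the second hypothesis makes $P / T^2$ vanish.

  All moments are computed inside a small calculus for polynomials in independent variables, in which
  the only probabilistic inputs are the moments of order 1, 2 and 4 of a standard Gaussian. The claim
  about the matrix laws follows from the one about the statistic, because total variation cannot grow
  under a measurable map.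
\<close>


section \<open>Polynomials in independent variables with Gaussian moments\<close>

text \<open>
  These three moments determine the expectation of every product of four variables: an odd multiplicity
  forces some variable to occur exactly once, and then independence gives zero.
  The index set is a parameter so that the same calculus serves the entries of a Gaussian rectangle and
  the entries of a GOE matrix above the diagonal.
\<close>
locale gaussian_family = prob_space M for M :: "'a measure" +
  fixes I :: "'p set" and \<xi> :: "'p \<Rightarrow> 'a \<Rightarrow> real"
  assumes indep: "indep_vars (\<lambda>_. borel) \<xi> I"
    and integrable_power: "\<And>p m. p \<in> I \<Longrightarrow> integrable M (\<lambda>\<omega>. \<xi> p \<omega> ^ m)"
    and moment_1: "\<And>p. p \<in> I \<Longrightarrow> expectation (\<lambda>\<omega>. \<xi> p \<omega>) = 0"
    and moment_2: "\<And>p. p \<in> I \<Longrightarrow> expectation (\<lambda>\<omega>. \<xi> p \<omega> ^ 2) = 1"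
    and moment_4: "\<And>p. p \<in> I \<Longrightarrow> expectation (\<lambda>\<omega>. \<xi> p \<omega> ^ 4) = 3"
begin

text \<open>
  Recording which variables a polynomial uses gives integrability and independence by syntax alone.
\<close>
inductive poly_in :: "'p set \<Rightarrow> ('a \<Rightarrow> real) \<Rightarrow> bool" for A where
  poly_const: "poly_in A (\<lambda>_. c)"
| poly_var: "p \<in> A \<Longrightarrow> poly_in A (\<lambda>\<omega>. \<xi> p \<omega>)"
| poly_add: "poly_in A f \<Longrightarrow> poly_in A g \<Longrightarrow> poly_in A (\<lambda>\<omega>. f \<omega> + g \<omega>)"
| poly_mult: "poly_in A f \<Longrightarrow> poly_in A g \<Longrightarrow> poly_in A (\<lambda>\<omega>. f \<omega> * g \<omega>)"

lemma poly_sum: "(\<And>a. a \<in> S \<Longrightarrow> poly_in A (f a)) \<Longrightarrow> poly_in A (\<lambda>\<omega>. \<Sum>a\<in>S. f a \<omega>)"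
  by (induction S rule: infinite_finite_induct) (auto intro: poly_in.intros)

lemma poly_power: "poly_in A f \<Longrightarrow> poly_in A (\<lambda>\<omega>. f \<omega> ^ m)"
  by (induction m) (auto intro: poly_in.intros)

lemmas poly_intros = poly_const poly_var poly_add poly_mult poly_sum poly_power

lemma poly_mono: "poly_in A f \<Longrightarrow> A \<subseteq> B \<Longrightarrow> poly_in B f"
  by (induction rule: poly_in.induct) (auto intro: poly_in.intros)

text \<open>
  This is the form in which independence of blocks of variables applies to polynomials.
\<close>
lemma poly_factors_through_variables:
  "poly_in A f \<Longrightarrow> \<exists>F\<in>borel_measurable (PiM A (\<lambda>_. borel)). f = F \<circ> (\<lambda>\<omega>. restrict (\<lambda>p. \<xi> p \<omega>) A)"
proof (induction rule: poly_in.induct)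
  case (poly_const c)
  show ?case by (rule bexI[of _ "\<lambda>_. c"]) auto
next
  case (poly_var p)
  then show ?case by (intro bexI[of _ "\<lambda>x. x p"]) auto
next
  case (poly_add f g)
  then obtain F G where "F \<in> borel_measurable (PiM A (\<lambda>_. borel))" "G \<in> borel_measurable (PiM A (\<lambda>_. borel))"
    "f = F \<circ> (\<lambda>\<omega>. restrict (\<lambda>p. \<xi> p \<omega>) A)" "g = G \<circ> (\<lambda>\<omega>. restrict (\<lambda>p. \<xi> p \<omega>) A)" by blast
  then show ?case by (intro bexI[of _ "\<lambda>x. F x + G x"]) (simp_all add: comp_def restrict_def)
next
  case (poly_mult f g)
  then obtain F G where "F \<in> borel_measurable (PiM A (\<lambda>_. borel))" "G \<in> borel_measurable (PiM A (\<lambda>_. borel))"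
    "f = F \<circ> (\<lambda>\<omega>. restrict (\<lambda>p. \<xi> p \<omega>) A)" "g = G \<circ> (\<lambda>\<omega>. restrict (\<lambda>p. \<xi> p \<omega>) A)" by blast
  then show ?case by (intro bexI[of _ "\<lambda>x. F x * G x"]) (simp_all add: comp_def restrict_def)
qed

lemma variable_measurable: "p \<in> I \<Longrightarrow> \<xi> p \<in> borel_measurable M"
  using indep by (auto simp: indep_vars_def)

lemma poly_measurable: "poly_in A f \<Longrightarrow> A \<subseteq> I \<Longrightarrow> f \<in> borel_measurable M"
  by (induction rule: poly_in.induct) (auto intro: variable_measurable)

text \<open>
  Integrability alone is not stable under products, but finiteness of all absolute moments is: a
  product is handled by $|xy|^m \le |x|^{2m} + |y|^{2m}$, which calls for higher moments of the factors.
\<close>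
lemma poly_abs_power_integrable:
  "poly_in A f \<Longrightarrow> A \<subseteq> I \<Longrightarrow> integrable M (\<lambda>\<omega>. \<bar>f \<omega>\<bar> ^ m)"
proof (induction arbitrary: m rule: poly_in.induct)
  case (poly_const c)
  show ?case by simp
next
  case (poly_var p)
  then show ?case
    using integrable_power[of p m] by (auto simp flip: power_abs)
next
  case (poly_add f g)
  note [measurable] = poly_measurable[OF poly_add.hyps(1) poly_add.prems]
    poly_measurable[OF poly_add.hyps(2) poly_add.prems]
  have bound: "\<bar>x + y\<bar> ^ m \<le> 2 ^ m * (\<bar>x\<bar> ^ m + \<bar>y\<bar> ^ m)" for x y :: real
  proof -
    have "\<bar>x + y\<bar> ^ m \<le> (2 * max \<bar>x\<bar> \<bar>y\<bar>) ^ m" by (intro power_mono) auto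
    also have "\<dots> = 2 ^ m * max \<bar>x\<bar> \<bar>y\<bar> ^ m" by (simp add: power_mult_distrib)
    also have "\<dots> \<le> 2 ^ m * (\<bar>x\<bar> ^ m + \<bar>y\<bar> ^ m)" by (auto simp: max_def)
    finally show ?thesis .
  qed
  have "integrable M (\<lambda>\<omega>. 2 ^ m * (\<bar>f \<omega>\<bar> ^ m + \<bar>g \<omega>\<bar> ^ m))"
    using poly_add by (intro integrable_mult_right Bochner_Integration.integrable_add) auto
  then show ?case
    by (rule Bochner_Integration.integrable_bound) (auto intro!: AE_I2 simp: bound abs_of_nonneg)
next
  case (poly_mult f g)
  note [measurable] = poly_measurable[OF poly_mult.hyps(1) poly_mult.prems]
    poly_measurable[OF poly_mult.hyps(2) poly_mult.prems]
  have bound: "\<bar>x * y\<bar> ^ m \<le> \<bar>x\<bar> ^ (2 * m) + \<bar>y\<bar> ^ (2 * m)" for x y :: real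
  proof -
    have "0 \<le> \<bar>x\<bar> ^ m * \<bar>y\<bar> ^ m" by simp
    moreover have "2 * (\<bar>x\<bar> ^ m * \<bar>y\<bar> ^ m) \<le> (\<bar>x\<bar> ^ m)\<^sup>2 + (\<bar>y\<bar> ^ m)\<^sup>2"
      using sum_squares_bound[of "\<bar>x\<bar> ^ m" "\<bar>y\<bar> ^ m"] by (simp add: mult.assoc)
    ultimately have "\<bar>x\<bar> ^ m * \<bar>y\<bar> ^ m \<le> (\<bar>x\<bar> ^ m)\<^sup>2 + (\<bar>y\<bar> ^ m)\<^sup>2" by linarith
    then show ?thesis
      by (simp add: abs_mult power_mult_distrib mult.commute[of 2 m] flip: power_mult)
  qed
  have "integrable M (\<lambda>\<omega>. \<bar>f \<omega>\<bar> ^ (2 * m) + \<bar>g \<omega>\<bar> ^ (2 * m))"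
    using poly_mult by (intro Bochner_Integration.integrable_add) auto
  then show ?case
    by (rule Bochner_Integration.integrable_bound) (auto intro!: AE_I2 simp: bound abs_of_nonneg)
qed

lemma poly_integrable: "poly_in A f \<Longrightarrow> A \<subseteq> I \<Longrightarrow> integrable M f"
  using poly_abs_power_integrable[of A f 1] poly_measurable[of A f]
  by (simp add: integrable_abs_iff)

lemma expectation_mult_disjoint:
  assumes "poly_in A f" "poly_in B g" "A \<inter> B = {}" "A \<subseteq> I" "B \<subseteq> I"
  shows "expectation (\<lambda>\<omega>. f \<omega> * g \<omega>) = expectation f * expectation g"
proof -
  obtain F where F: "F \<in> borel_measurable (PiM A (\<lambda>_. borel))"
    "f = F \<circ> (\<lambda>\<omega>. restrict (\<lambda>p. \<xi> p \<omega>) A)"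
    using poly_factors_through_variables[OF assms(1)] by blast
  obtain G where G: "G \<in> borel_measurable (PiM B (\<lambda>_. borel))"
    "g = G \<circ> (\<lambda>\<omega>. restrict (\<lambda>p. \<xi> p \<omega>) B)"
    using poly_factors_through_variables[OF assms(2)] by blast
  have "indep_var borel f borel g"
    unfolding F(2) G(2)
    by (rule indep_var_compose[OF indep_var_restrict[OF indep assms(3-5)] F(1) G(1)])
  then show ?thesis
    using assms by (intro indep_var_lebesgue_integral) (auto intro: poly_integrable)
qed

text \<open>
  A variable that occurs exactly once can be split off by independence and is centred. This is the
  reason for nearly every vanishing moment below.
\<close>
lemma expectation_lone_variable:
  assumes "p \<in> I" "poly_in A f" "A \<subseteq> I - {p}"
  shows "expectation (\<lambda>\<omega>. \<xi> p \<omega> * f \<omega>) = 0"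
proof -
  have "expectation (\<lambda>\<omega>. \<xi> p \<omega> * f \<omega>) = expectation (\<xi> p) * expectation f"
    using assms by (intro expectation_mult_disjoint[of "{p}" _ A]) (auto intro: poly_intros)
  then show ?thesis using moment_1[OF assms(1)] by simp
qed

abbreviation \<delta> :: "'b \<Rightarrow> 'b \<Rightarrow> real" where "\<delta> a b \<equiv> (if a = b then 1 else 0)"

lemma expectation_pair:
  assumes "p \<in> I" "q \<in> I"
  shows "expectation (\<lambda>\<omega>. \<xi> p \<omega> * \<xi> q \<omega>) = \<delta> p q"
proof (cases "p = q")
  case True
  then show ?thesis using moment_2[OF assms(1)] by (simp add: power2_eq_square)
next
  case False
  then show ?thesis
    using assms by (auto intro!: expectation_lone_variable[of _ "{q}"] poly_intros)
qed

lemma expectation_two_squares: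
  assumes "p \<in> I" "q \<in> I" "p \<noteq> q"
  shows "expectation (\<lambda>\<omega>. (\<xi> p \<omega>)\<^sup>2 * (\<xi> q \<omega>)\<^sup>2) = 1"
  using assms by (subst expectation_mult_disjoint[of "{p}" _ "{q}"]) (auto intro!: poly_intros simp: moment_2)

text \<open>
  Isserlis' formula of order four. If some index is different from the other three, both sides vanish;
  otherwise all indices agree or they form two pairs, which leaves the fourth moment or a product of two
  second moments.
\<close>
lemma expectation_four:
  assumes I: "p \<in> I" "q \<in> I" "r \<in> I" "s \<in> I"
  shows "expectation (\<lambda>\<omega>. \<xi> p \<omega> * \<xi> q \<omega> * \<xi> r \<omega> * \<xi> s \<omega>)
    = \<delta> p q * \<delta> r s + \<delta> p r * \<delta> q s + \<delta> p s * \<delta> q r"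
proof -
  have lone: "expectation (\<lambda>\<omega>. \<xi> p' \<omega> * (\<xi> q' \<omega> * \<xi> r' \<omega> * \<xi> s' \<omega>)) = 0"
    if "p' \<in> I" "q' \<in> I" "r' \<in> I" "s' \<in> I" "p' \<notin> {q', r', s'}" for p' q' r' s'
    using that by (intro expectation_lone_variable[of _ "{q', r', s'}"]) (auto intro!: poly_intros)
  consider "p \<notin> {q, r, s}" | "q \<notin> {p, r, s}" | "r \<notin> {p, q, s}" | "s \<notin> {p, q, r}"
    | "p = q" "q = r" "r = s" | "p = q" "r = s" "p \<noteq> r" | "p = r" "q = s" "p \<noteq> q" | "p = s" "q = r" "p \<noteq> q"
    by auto
  then show ?thesis
  proof cases
    case 1 then show ?thesis using lone[of p q r s] I by (auto simp: ac_simps)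
  next
    case 2 then show ?thesis using lone[of q p r s] I by (auto simp: ac_simps)
  next
    case 3 then show ?thesis using lone[of r p q s] I by (auto simp: ac_simps)
  next
    case 4 then show ?thesis using lone[of s p q r] I by (auto simp: ac_simps)
  next
    case 5 then show ?thesis using moment_4[of p] I by (simp add: power4_eq_xxxx)
  next
    case 6 then show ?thesis using expectation_two_squares[of p r] I by (simp add: power2_eq_square ac_simps)
  next
    case 7 then show ?thesis using expectation_two_squares[of p q] I by (simp add: power2_eq_square ac_simps)
  next
    case 8 then show ?thesis using expectation_two_squares[of p q] I by (simp add: power2_eq_square ac_simps)
  qed
qed

end

section \<open>Averaging out one Gaussian column\<close>

text \<open>
  Each pairing of the four positions in \<open>expectation_four\<close> keeps one diagonal of a fourfold sum.
\<close>
lemma sum_over_pairings: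
  fixes T :: "'b \<Rightarrow> 'b \<Rightarrow> 'b \<Rightarrow> 'b \<Rightarrow> real"
  assumes "finite S"
  shows "(\<Sum>a\<in>S. \<Sum>b\<in>S. \<Sum>c\<in>S. \<Sum>e\<in>S. T a b c e *
      ((if a = b then 1 else 0) * (if c = e then 1 else 0) + (if a = c then 1 else 0) * (if b = e then 1 else 0)
        + (if a = e then 1 else 0) * (if b = c then 1 else 0)))
    = (\<Sum>a\<in>S. \<Sum>c\<in>S. T a a c c) + (\<Sum>a\<in>S. \<Sum>b\<in>S. T a b a b) + (\<Sum>a\<in>S. \<Sum>b\<in>S. T a b b a)"
proof -
  have out: "(\<Sum>c\<in>S. if P then f c else 0) = (if P then sum f S else 0)" for P and f :: "'b \<Rightarrow> real"
    by simp
  have 1: "(\<Sum>a\<in>S. \<Sum>b\<in>S. \<Sum>c\<in>S. \<Sum>e\<in>S. T a b c e * ((if a = b then 1 else 0) * (if c = e then 1 else 0)))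
    = (\<Sum>a\<in>S. \<Sum>c\<in>S. T a a c c)" 
    using assms by (simp add: if_distrib[of "(*) _"] sum.delta' if_distribR out cong: if_cong flip: mult.assoc sum_distrib_right)
  have 2: "(\<Sum>a\<in>S. \<Sum>b\<in>S. \<Sum>c\<in>S. \<Sum>e\<in>S. T a b c e * ((if a = c then 1 else 0) * (if b = e then 1 else 0)))
    = (\<Sum>a\<in>S. \<Sum>b\<in>S. T a b a b)"
    using assms by (simp add: if_distrib[of "(*) _"] sum.delta' if_distribR out cong: if_cong flip: mult.assoc sum_distrib_right)
  have 3: "(\<Sum>a\<in>S. \<Sum>b\<in>S. \<Sum>c\<in>S. \<Sum>e\<in>S. T a b c e * ((if a = e then 1 else 0) * (if b = c then 1 else 0)))
    = (\<Sum>a\<in>S. \<Sum>b\<in>S. T a b b a)"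
    using assms by (simp add: if_distrib[of "(*) _"] sum.delta' if_distribR out cong: if_cong flip: mult.assoc sum_distrib_right)
  show ?thesis
    unfolding distrib_left sum.distrib 1 2 3 ..
qed

text \<open>
  The variable at \<open>(a, i)\<close> is the entry in row \<open>a\<close> of column \<open>i\<close>, and column \<open>i\<close> plays the role of a
  Gaussian vector attached to the vertex \<open>i\<close>.
\<close>
locale gaussian_columns = gaussian_family M "{1..d} \<times> V" \<xi>
  for M :: "'a measure" and d :: nat and V :: "nat set" and \<xi> :: "nat \<times> nat \<Rightarrow> 'a \<Rightarrow> real"
begin

abbreviation col_poly :: "nat set \<Rightarrow> ('a \<Rightarrow> real) \<Rightarrow> bool" where
  "col_poly J \<equiv> poly_in ({1..d} \<times> J)"

text \<open>
  Averaging over the column \<open>k\<close>: for vectors $u$, $v$ and a factor $h$ built from other columns, a standard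
  Gaussian vector $x$ satisfies $E \langle u, x\rangle \langle v, x\rangle = \langle u, v\rangle$.
\<close>
lemma expectation_contract:
  assumes k: "k \<in> V" "k \<notin> J" and J: "J \<subseteq> V"
    and h: "col_poly J h" and u: "\<And>a. a \<in> {1..d} \<Longrightarrow> col_poly J (u a)"
    and v: "\<And>a. a \<in> {1..d} \<Longrightarrow> col_poly J (v a)"
  shows "expectation (\<lambda>\<omega>. h \<omega> * (\<Sum>a=1..d. u a \<omega> * \<xi> (a, k) \<omega>) * (\<Sum>a=1..d. v a \<omega> * \<xi> (a, k) \<omega>))
    = expectation (\<lambda>\<omega>. h \<omega> * (\<Sum>a=1..d. u a \<omega> * v a \<omega>))"
proof -
  have split: "expectation (\<lambda>\<omega>. (h \<omega> * u a \<omega> * v b \<omega>) * (\<xi> (a, k) \<omega> * \<xi> (b, k) \<omega>))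
      = expectation (\<lambda>\<omega>. h \<omega> * u a \<omega> * v b \<omega>) * (if a = b then 1 else 0)"
    if ab: "a \<in> {1..d}" "b \<in> {1..d}" for a b
  proof (subst expectation_mult_disjoint[of "{1..d} \<times> J" _ "{1..d} \<times> {k}"])
    show "col_poly J (\<lambda>\<omega>. h \<omega> * u a \<omega> * v b \<omega>)" using h u v ab by (intro poly_intros) auto
    show "col_poly {k} (\<lambda>\<omega>. \<xi> (a, k) \<omega> * \<xi> (b, k) \<omega>)" using ab by (intro poly_intros) auto
  qed (use k J ab expectation_pair[of "(a, k)" "(b, k)"] in auto)
  have int: "integrable M (\<lambda>\<omega>. (h \<omega> * u a \<omega> * v b \<omega>) * (\<xi> (a, k) \<omega> * \<xi> (b, k) \<omega>))"
    if ab: "a \<in> {1..d}" "b \<in> {1..d}" for a b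
    using h u v ab k J
    by (intro poly_integrable[of "{1..d} \<times> insert k J"] poly_intros)
      (auto intro: poly_mono[of "{1..d} \<times> J"])
  have int': "integrable M (\<lambda>\<omega>. h \<omega> * u a \<omega> * v a \<omega>)" if a: "a \<in> {1..d}" for a
    using h u v a J by (intro poly_integrable[of "{1..d} \<times> J"] poly_intros) auto
  have "expectation (\<lambda>\<omega>. h \<omega> * (\<Sum>a=1..d. u a \<omega> * \<xi> (a, k) \<omega>) * (\<Sum>a=1..d. v a \<omega> * \<xi> (a, k) \<omega>))
    = expectation (\<lambda>\<omega>. \<Sum>a=1..d. \<Sum>b=1..d. (h \<omega> * u a \<omega> * v b \<omega>) * (\<xi> (a, k) \<omega> * \<xi> (b, k) \<omega>))"
    by (simp add: sum_distrib_left sum_distrib_right sum_product mult_ac)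
  also have "\<dots> = (\<Sum>a=1..d. \<Sum>b=1..d. expectation (\<lambda>\<omega>. h \<omega> * u a \<omega> * v b \<omega>) * (if a = b then 1 else 0))"
    using int by (simp only: Bochner_Integration.integral_sum Bochner_Integration.integrable_sum split cong: sum.cong)
  also have "\<dots> = (\<Sum>a=1..d. expectation (\<lambda>\<omega>. h \<omega> * u a \<omega> * v a \<omega>))"
    by (simp add: if_distrib[of "(*) _"] cong: if_cong)
  also have "\<dots> = expectation (\<lambda>\<omega>. \<Sum>a=1..d. h \<omega> * u a \<omega> * v a \<omega>)"
    using int' by (simp add: Bochner_Integration.integral_sum)
  finally show ?thesis by (simp add: sum_distrib_left mult_ac)
qed

text \<open>
  The same averaging for $E \langle u, x\rangle^2 \langle v, x\rangle^2 = |u|^2 |v|^2 + 2 \langle u, v\rangle^2$,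
  which is \<open>expectation_four\<close> summed over the coordinates.
\<close>
lemma expectation_contract_squares:
  assumes k: "k \<in> V" "k \<notin> J" and J: "J \<subseteq> V"
    and h: "col_poly J h" and u: "\<And>a. a \<in> {1..d} \<Longrightarrow> col_poly J (u a)"
    and v: "\<And>a. a \<in> {1..d} \<Longrightarrow> col_poly J (v a)"
  shows "expectation (\<lambda>\<omega>. h \<omega> * (\<Sum>a=1..d. u a \<omega> * \<xi> (a, k) \<omega>)\<^sup>2 * (\<Sum>a=1..d. v a \<omega> * \<xi> (a, k) \<omega>)\<^sup>2)
    = expectation (\<lambda>\<omega>. h \<omega> * (\<Sum>a=1..d. (u a \<omega>)\<^sup>2) * (\<Sum>a=1..d. (v a \<omega>)\<^sup>2))
      + 2 * expectation (\<lambda>\<omega>. h \<omega> * (\<Sum>a=1..d. u a \<omega> * v a \<omega>)\<^sup>2)"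
proof -
  \<comment> \<open>The factors alternate between \<open>u\<close> and \<open>v\<close> because this is how the product of the squared sums expands.\<close>
  let ?c = "\<lambda>a b c e \<omega>. h \<omega> * u a \<omega> * v b \<omega> * u c \<omega> * v e \<omega>"
  let ?x = "\<lambda>a b c e \<omega>. \<xi> (a, k) \<omega> * \<xi> (b, k) \<omega> * \<xi> (c, k) \<omega> * \<xi> (e, k) \<omega>"
  let ?P = "\<lambda>a b c e. (if a = b then 1 else 0) * (if c = e then 1 else 0) + (if a = c then 1 else 0) * (if b = e then 1 else 0)
        + (if a = e then 1 else 0) * (if b = c then 1 else (0::real))"
  have poly_c: "col_poly J (?c a b c e)"
    if "a \<in> {1..d}" "b \<in> {1..d}" "c \<in> {1..d}" "e \<in> {1..d}" for a b c e
    using h u v that by (intro poly_intros) auto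
  have poly_x: "col_poly {k} (?x a b c e)"
    if "a \<in> {1..d}" "b \<in> {1..d}" "c \<in> {1..d}" "e \<in> {1..d}" for a b c e
    using that by (intro poly_intros) auto
  have split: "expectation (\<lambda>\<omega>. ?c a b c e \<omega> * ?x a b c e \<omega>) = expectation (?c a b c e) * ?P a b c e"
    if abce: "a \<in> {1..d}" "b \<in> {1..d}" "c \<in> {1..d}" "e \<in> {1..d}" for a b c e
  proof (subst expectation_mult_disjoint[OF poly_c[OF abce] poly_x[OF abce]])
    show "expectation (?c a b c e) * expectation (?x a b c e) = expectation (?c a b c e) * ?P a b c e"
      using k abce expectation_four[of "(a, k)" "(b, k)" "(c, k)" "(e, k)"] by simp
  qed (use k J in auto)
  have int_c: "integrable M (?c a b c e)"
    if "a \<in> {1..d}" "b \<in> {1..d}" "c \<in> {1..d}" "e \<in> {1..d}" for a b c e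
    using J by (intro poly_integrable[OF poly_c[OF that]]) auto
  have int: "integrable M (\<lambda>\<omega>. ?c a b c e \<omega> * ?x a b c e \<omega>)"
    if abce: "a \<in> {1..d}" "b \<in> {1..d}" "c \<in> {1..d}" "e \<in> {1..d}" for a b c e
    using k J
    by (intro poly_integrable[of "{1..d} \<times> insert k J"] poly_mult
        poly_mono[OF poly_c[OF abce]] poly_mono[OF poly_x[OF abce]]) auto
  have "expectation (\<lambda>\<omega>. h \<omega> * (\<Sum>a=1..d. u a \<omega> * \<xi> (a, k) \<omega>)\<^sup>2 * (\<Sum>a=1..d. v a \<omega> * \<xi> (a, k) \<omega>)\<^sup>2)
    = expectation (\<lambda>\<omega>. \<Sum>a=1..d. \<Sum>b=1..d. \<Sum>c=1..d. \<Sum>e=1..d. ?c a b c e \<omega> * ?x a b c e \<omega>)"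
    by (simp only: power2_eq_square sum_product sum_distrib_left sum_distrib_right mult_ac)
  also have "\<dots> = (\<Sum>a=1..d. \<Sum>b=1..d. \<Sum>c=1..d. \<Sum>e=1..d. expectation (\<lambda>\<omega>. ?c a b c e \<omega> * ?x a b c e \<omega>))"
    using int by (simp only: Bochner_Integration.integral_sum Bochner_Integration.integrable_sum cong: sum.cong)
  also have "\<dots> = (\<Sum>a=1..d. \<Sum>b=1..d. \<Sum>c=1..d. \<Sum>e=1..d. expectation (?c a b c e) * ?P a b c e)"
    by (intro sum.cong refl split)
  also have "\<dots> = (\<Sum>a=1..d. \<Sum>c=1..d. expectation (?c a a c c)) + (\<Sum>a=1..d. \<Sum>b=1..d. expectation (?c a b a b))
      + (\<Sum>a=1..d. \<Sum>b=1..d. expectation (?c a b b a))"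
    by (rule sum_over_pairings) simp
  also have "\<dots> = expectation (\<lambda>\<omega>. \<Sum>a=1..d. \<Sum>c=1..d. ?c a a c c \<omega>) + expectation (\<lambda>\<omega>. \<Sum>a=1..d. \<Sum>b=1..d. ?c a b a b \<omega>)
      + expectation (\<lambda>\<omega>. \<Sum>a=1..d. \<Sum>b=1..d. ?c a b b a \<omega>)"
    using int_c by (simp only: Bochner_Integration.integral_sum Bochner_Integration.integrable_sum cong: sum.cong)
  also have "(\<lambda>\<omega>. \<Sum>a=1..d. \<Sum>c=1..d. ?c a a c c \<omega>) = (\<lambda>\<omega>. h \<omega> * (\<Sum>a=1..d. u a \<omega> * v a \<omega>)\<^sup>2)"
    by (simp only: power2_eq_square sum_product sum_distrib_left sum_distrib_right mult_ac)
  also have "(\<lambda>\<omega>. \<Sum>a=1..d. \<Sum>b=1..d. ?c a b a b \<omega>) = (\<lambda>\<omega>. h \<omega> * (\<Sum>a=1..d. (u a \<omega>)\<^sup>2) * (\<Sum>a=1..d. (v a \<omega>)\<^sup>2))"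
    by (simp only: power2_eq_square sum_product sum_distrib_left sum_distrib_right mult_ac)
  also have "(\<lambda>\<omega>. \<Sum>a=1..d. \<Sum>b=1..d. ?c a b b a \<omega>) = (\<lambda>\<omega>. h \<omega> * (\<Sum>a=1..d. u a \<omega> * v a \<omega>)\<^sup>2)"
    by (simp only: power2_eq_square sum_product sum_distrib_left sum_distrib_right mult_ac)
  finally show ?thesis by simp
qed

end

section \<open>Joint moments of triangle products in a Gram matrix\<close>

context gaussian_columns begin

\<comment> \<open>The row index sets start at 1; unfolding 1 would hide them from the rules for polynomials.\<close>
declare One_nat_def [simp del]

text \<open>
  The entry of $X^\top X$ at \<open>(i, j)\<close>, which is the squared norm of the column \<open>i\<close> when \<open>i = j\<close>.
\<close>
definition gram :: "nat \<Rightarrow> nat \<Rightarrow> 'a \<Rightarrow> real" where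
  "gram i j \<omega> = (\<Sum>a=1..d. \<xi> (a, i) \<omega> * \<xi> (a, j) \<omega>)"

definition triangle_product :: "nat \<Rightarrow> nat \<Rightarrow> nat \<Rightarrow> 'a \<Rightarrow> real" where
  "triangle_product i j k \<omega> = gram i j \<omega> * gram j k \<omega> * gram k i \<omega>"

lemma gram_commute: "gram i j = gram j i"
  by (simp add: gram_def fun_eq_iff mult.commute)

lemma poly_gram: "i \<in> J \<Longrightarrow> j \<in> J \<Longrightarrow> col_poly J (gram i j)"
  unfolding gram_def[abs_def] by (intro poly_intros) auto

lemma poly_triangle_product:
  "i \<in> J \<Longrightarrow> j \<in> J \<Longrightarrow> k \<in> J \<Longrightarrow> col_poly J (triangle_product i j k)"
  unfolding triangle_product_def[abs_def] by (intro poly_intros poly_gram)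

lemma col_poly_integrable: "col_poly J f \<Longrightarrow> J \<subseteq> V \<Longrightarrow> integrable M f"
  by (rule poly_integrable) auto

text \<open>
  Contracting a path through the vertex \<open>k\<close> to a single edge is the step that computes every mixed
  moment of triangles.
\<close>
lemma expectation_gram_contract:
  assumes "k \<in> V" "k \<notin> J" "J \<subseteq> V" "col_poly J h" "i \<in> J" "j \<in> J"
  shows "expectation (\<lambda>\<omega>. h \<omega> * gram i k \<omega> * gram k j \<omega>) = expectation (\<lambda>\<omega>. h \<omega> * gram i j \<omega>)"
  using expectation_contract[of k J h "\<lambda>a. \<xi> (a, i)" "\<lambda>a. \<xi> (a, j)"] assms
  by (simp add: gram_commute[of k j]) (simp add: gram_def poly_var)

lemma expectation_gram_contract_squares:
  assumes "k \<in> V" "k \<notin> J" "J \<subseteq> V" "col_poly J h" "i \<in> J" "j \<in> J"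
  shows "expectation (\<lambda>\<omega>. h \<omega> * (gram i k \<omega>)\<^sup>2 * (gram k j \<omega>)\<^sup>2)
    = expectation (\<lambda>\<omega>. h \<omega> * gram i i \<omega> * gram j j \<omega>) + 2 * expectation (\<lambda>\<omega>. h \<omega> * (gram i j \<omega>)\<^sup>2)"
  using expectation_contract_squares[of k J h "\<lambda>a. \<xi> (a, i)" "\<lambda>a. \<xi> (a, j)"] assms
  by (simp add: gram_commute[of k j]) (simp add: gram_def poly_var power2_eq_square)

text \<open>
  The squared norm is a sum over coordinates $b$, and the coordinate $x_b$ is the inner product of $x$ with a unit
  vector, so \<open>expectation_contract_squares\<close> applies with a deterministic second vector.
\<close>
lemma expectation_gram_square_norm:
  assumes "k \<in> V" "k \<notin> J" "J \<subseteq> V" "col_poly J h" "i \<in> J"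
  shows "expectation (\<lambda>\<omega>. h \<omega> * (gram i k \<omega>)\<^sup>2 * gram k k \<omega>)
    = (real d + 2) * expectation (\<lambda>\<omega>. h \<omega> * gram i i \<omega>)"
proof -
  have one: "expectation (\<lambda>\<omega>. h \<omega> * (gram i k \<omega>)\<^sup>2 * (\<xi> (b, k) \<omega>)\<^sup>2)
      = expectation (\<lambda>\<omega>. h \<omega> * gram i i \<omega>) + 2 * expectation (\<lambda>\<omega>. h \<omega> * (\<xi> (b, i) \<omega>)\<^sup>2)"
    if b: "b \<in> {1..d}" for b
  proof -
    have pick: "(\<Sum>a=1..d. (if a = b then 1 else 0) * f a) = f b"
      "(\<Sum>a=1..d. f a * (if a = b then 1 else 0)) = f b" for f :: "nat \<Rightarrow> real"
      using b by (simp_all add: if_distrib[of "(*) _"] if_distrib[of "\<lambda>x. x * _"] cong: if_cong)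
    show ?thesis
      using expectation_contract_squares[of k J h "\<lambda>a. \<xi> (a, i)" "\<lambda>a _. if a = b then 1 else 0"] assms
      by (simp add: poly_var poly_const gram_def power2_eq_square pick del: mult_if_delta)
  qed
  have poly: "col_poly (insert k J) (\<lambda>\<omega>. h \<omega> * (gram i k \<omega>)\<^sup>2 * (\<xi> (b, k) \<omega>)\<^sup>2)" if "b \<in> {1..d}" for b
  proof -
    have "col_poly (insert k J) h" using assms by (auto intro: poly_mono)
    then show ?thesis using assms that by (intro poly_intros poly_gram) auto
  qed
  have poly': "col_poly J (\<lambda>\<omega>. h \<omega> * (\<xi> (b, i) \<omega>)\<^sup>2)" if "b \<in> {1..d}" for b
    using assms that by (intro poly_intros) auto
  have "expectation (\<lambda>\<omega>. h \<omega> * (gram i k \<omega>)\<^sup>2 * gram k k \<omega>)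
    = expectation (\<lambda>\<omega>. \<Sum>b=1..d. h \<omega> * (gram i k \<omega>)\<^sup>2 * (\<xi> (b, k) \<omega>)\<^sup>2)"
    by (simp add: gram_def[of k k] sum_distrib_left power2_eq_square)
  also have "\<dots> = (\<Sum>b=1..d. expectation (\<lambda>\<omega>. h \<omega> * (gram i k \<omega>)\<^sup>2 * (\<xi> (b, k) \<omega>)\<^sup>2))"
    using assms by (intro Bochner_Integration.integral_sum col_poly_integrable[OF poly]) auto
  also have "\<dots> = (\<Sum>b=1..d. expectation (\<lambda>\<omega>. h \<omega> * gram i i \<omega>) + 2 * expectation (\<lambda>\<omega>. h \<omega> * (\<xi> (b, i) \<omega>)\<^sup>2))"
    by (intro sum.cong refl one)
  also have "\<dots> = d * expectation (\<lambda>\<omega>. h \<omega> * gram i i \<omega>) + 2 * (\<Sum>b=1..d. expectation (\<lambda>\<omega>. h \<omega> * (\<xi> (b, i) \<omega>)\<^sup>2))"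
    by (simp add: sum.distrib sum_distrib_left)
  also have "(\<Sum>b=1..d. expectation (\<lambda>\<omega>. h \<omega> * (\<xi> (b, i) \<omega>)\<^sup>2)) = expectation (\<lambda>\<omega>. \<Sum>b=1..d. h \<omega> * (\<xi> (b, i) \<omega>)\<^sup>2)"
    using assms by (intro Bochner_Integration.integral_sum[symmetric] col_poly_integrable[OF poly']) auto
  also have "\<dots> = expectation (\<lambda>\<omega>. h \<omega> * gram i i \<omega>)"
    by (simp add: gram_def sum_distrib_left power2_eq_square)
  finally show ?thesis by (simp add: algebra_simps)
qed

lemma expectation_norm:
  assumes "i \<in> V"
  shows "expectation (gram i i) = real d"
proof -
  have "expectation (gram i i) = (\<Sum>a=1..d. expectation (\<lambda>\<omega>. \<xi> (a, i) \<omega> * \<xi> (a, i) \<omega>))"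
    unfolding gram_def using assms
    by (intro Bochner_Integration.integral_sum col_poly_integrable[of "{i}"] poly_intros) auto
  then show ?thesis using assms by (simp add: expectation_pair)
qed

lemma expectation_norm_square:
  assumes i: "i \<in> V"
  shows "expectation (\<lambda>\<omega>. (gram i i \<omega>)\<^sup>2) = real d ^ 2 + 2 * real d"
proof -
  let ?x = "\<lambda>a b \<omega>. \<xi> (a, i) \<omega> * \<xi> (a, i) \<omega> * \<xi> (b, i) \<omega> * \<xi> (b, i) \<omega>"
  have int: "integrable M (?x a b)" if "a \<in> {1..d}" "b \<in> {1..d}" for a b
    using that i by (intro col_poly_integrable[of "{i}"] poly_intros) auto
  have "expectation (\<lambda>\<omega>. (gram i i \<omega>)\<^sup>2) = expectation (\<lambda>\<omega>. \<Sum>a=1..d. \<Sum>b=1..d. ?x a b \<omega>)"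
    by (simp add: gram_def power2_eq_square sum_product mult.assoc)
  also have "\<dots> = (\<Sum>a=1..d. \<Sum>b=1..d. expectation (?x a b))"
    using int by (simp only: Bochner_Integration.integral_sum Bochner_Integration.integrable_sum cong: sum.cong)
  also have "\<dots> = (\<Sum>a=1..d. \<Sum>b=1..d. 1 + 2 * (if a = b then 1 else 0))"
    using i by (intro sum.cong refl, subst expectation_four) auto
  also have "\<dots> = real d ^ 2 + 2 * real d"
    by (simp add: sum.distrib power2_eq_square algebra_simps flip: sum_distrib_left)
  finally show ?thesis .
qed

text \<open>
  Given one column, the other one is averaged with both vectors equal, leaving three times the fourth power of a norm.
\<close>
lemma expectation_gram_fourth:
  assumes "i \<in> V" "j \<in> V" "i \<noteq> j"
  shows "expectation (\<lambda>\<omega>. (gram i j \<omega>)\<^sup>2 * (gram i j \<omega>)\<^sup>2) = 3 * real d ^ 2 + 6 * real d"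
  using expectation_gram_contract_squares[of j "{i}" "\<lambda>_. 1" i i] assms expectation_norm_square[of i]
  by (simp add: poly_const gram_commute[of j i] power2_eq_square)

text \<open>
  Contract \<open>k\<close>, then \<open>j\<close>: the triangle shrinks to the squared norm of the column \<open>i\<close>.
\<close>
lemma expectation_triangle_product:
  assumes V: "{i, j, k} \<subseteq> V" and "distinct [i, j, k]"
  shows "expectation (triangle_product i j k) = real d"
proof -
  have "expectation (triangle_product i j k) = expectation (\<lambda>\<omega>. gram i j \<omega> * gram i k \<omega> * gram k j \<omega>)"
    by (simp add: triangle_product_def[abs_def] gram_commute[of k i] gram_commute[of j k] mult_ac)
  also have "\<dots> = expectation (\<lambda>\<omega>. 1 * gram i j \<omega> * gram j i \<omega>)"
    using assms
    by (subst expectation_gram_contract[of k "{i, j}"]) (auto intro: poly_gram simp: gram_commute[of j i])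
  also have "\<dots> = expectation (gram i i)"
    using assms by (subst expectation_gram_contract[of j "{i}"]) (auto intro: poly_const)
  finally show ?thesis using expectation_norm V by simp
qed

text \<open>
  Averaging over \<open>k\<close> replaces the two squared edges at \<open>k\<close> by a product of squared norms and by a further
  squared edge between \<open>i\<close> and \<open>j\<close>; the two resulting terms are the two previous moments.
\<close>
lemma expectation_triangle_product_square:
  assumes V: "{i, j, k} \<subseteq> V" and "distinct [i, j, k]"
  shows "expectation (\<lambda>\<omega>. triangle_product i j k \<omega> * triangle_product i j k \<omega>)
    = real d * (real d + 2) * (real d + 8)"
proof -
  have "expectation (\<lambda>\<omega>. triangle_product i j k \<omega> * triangle_product i j k \<omega>)
      = expectation (\<lambda>\<omega>. (gram i j \<omega>)\<^sup>2 * (gram i k \<omega>)\<^sup>2 * (gram k j \<omega>)\<^sup>2)"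
    by (simp add: triangle_product_def[abs_def] gram_commute[of k i] gram_commute[of j k] mult_ac power2_eq_square)
  also have "\<dots> = expectation (\<lambda>\<omega>. gram i i \<omega> * (gram i j \<omega>)\<^sup>2 * gram j j \<omega>)
      + 2 * expectation (\<lambda>\<omega>. (gram i j \<omega>)\<^sup>2 * (gram i j \<omega>)\<^sup>2)"
    using assms by (subst expectation_gram_contract_squares[of k "{i, j}"])
      (auto intro!: poly_gram poly_power simp: mult_ac)
  also have "expectation (\<lambda>\<omega>. gram i i \<omega> * (gram i j \<omega>)\<^sup>2 * gram j j \<omega>) = (real d + 2) * (real d ^ 2 + 2 * real d)"
    using assms by (subst expectation_gram_square_norm[of j "{i}"])
      (auto intro!: poly_gram simp: expectation_norm_square simp flip: power2_eq_square)
  also have "expectation (\<lambda>\<omega>. (gram i j \<omega>)\<^sup>2 * (gram i j \<omega>)\<^sup>2) = 3 * real d ^ 2 + 6 * real d"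
    using assms by (intro expectation_gram_fourth) auto
  finally show ?thesis by (simp add: algebra_simps power2_eq_square)
qed

text \<open>
  Contracting the two apexes turns both triangles into further copies of the common edge, so that four
  copies of it remain.
\<close>
lemma expectation_triangles_sharing_edge:
  assumes V: "{i, j, k, l} \<subseteq> V" and "distinct [i, j, k, l]"
  shows "expectation (\<lambda>\<omega>. triangle_product i j k \<omega> * triangle_product i j l \<omega>)
    = 3 * real d ^ 2 + 6 * real d"
proof -
  have "expectation (\<lambda>\<omega>. triangle_product i j k \<omega> * triangle_product i j l \<omega>)
      = expectation (\<lambda>\<omega>. ((gram i j \<omega>)\<^sup>2 * gram i l \<omega> * gram l j \<omega>) * gram i k \<omega> * gram k j \<omega>)"
    by (simp add: triangle_product_def[abs_def] gram_commute[of k i] gram_commute[of j k] gram_commute[of l i]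
        gram_commute[of j l] mult_ac power2_eq_square)
  also have "\<dots> = expectation (\<lambda>\<omega>. ((gram i j \<omega>)\<^sup>2 * gram i j \<omega>) * gram i l \<omega> * gram l j \<omega>)"
    using assms by (subst expectation_gram_contract[of k "{i, j, l}"])
      (auto intro!: poly_gram poly_intros simp: mult_ac)
  also have "\<dots> = expectation (\<lambda>\<omega>. (gram i j \<omega>)\<^sup>2 * (gram i j \<omega>)\<^sup>2)"
    using assms by (subst expectation_gram_contract[of l "{i, j}"])
      (auto intro!: poly_gram poly_intros simp: mult_ac power2_eq_square)
  finally show ?thesis using assms expectation_gram_fourth[of i j] by simp
qed

text \<open>
  Each triangle contracts to the squared norm of the column at the common vertex. The excess over
  $d^2$ is thus the variance $2 d$ of that squared norm.
\<close>
lemma expectation_triangles_sharing_vertex: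
  assumes V: "{i, j, k, l, m} \<subseteq> V" and "distinct [i, j, k, l, m]"
  shows "expectation (\<lambda>\<omega>. triangle_product i j k \<omega> * triangle_product i l m \<omega>)
    = real d ^ 2 + 2 * real d"
proof -
  have "expectation (\<lambda>\<omega>. triangle_product i j k \<omega> * triangle_product i l m \<omega>)
      = expectation (\<lambda>\<omega>. (triangle_product i l m \<omega> * gram i j \<omega>) * gram i k \<omega> * gram k j \<omega>)"
    by (simp add: triangle_product_def[of i j k] gram_commute[of k i] gram_commute[of j k] mult_ac)
  also have "\<dots> = expectation (\<lambda>\<omega>. triangle_product i l m \<omega> * gram i j \<omega> * gram j i \<omega>)"
    using assms by (subst expectation_gram_contract[of k "{i, j, l, m}"])
      (auto intro!: poly_triangle_product poly_gram poly_mult simp: mult_ac gram_commute[of j i])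
  also have "\<dots> = expectation (\<lambda>\<omega>. triangle_product i l m \<omega> * gram i i \<omega>)"
    using assms by (subst expectation_gram_contract[of j "{i, l, m}"])
      (auto intro!: poly_triangle_product poly_gram)
  also have "\<dots> = expectation (\<lambda>\<omega>. (gram i i \<omega> * gram i l \<omega>) * gram i m \<omega> * gram m l \<omega>)"
    by (simp add: triangle_product_def[abs_def] gram_commute[of m i] gram_commute[of l m] mult_ac)
  also have "\<dots> = expectation (\<lambda>\<omega>. gram i i \<omega> * gram i l \<omega> * gram l i \<omega>)"
    using assms by (subst expectation_gram_contract[of m "{i, l}"])
      (auto intro!: poly_gram poly_mult simp: mult_ac gram_commute[of l i])
  also have "\<dots> = expectation (\<lambda>\<omega>. (gram i i \<omega>)\<^sup>2)"
    using assms by (subst expectation_gram_contract[of l "{i}"])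
      (auto intro!: poly_gram simp: power2_eq_square)
  finally show ?thesis using assms expectation_norm_square[of i] by simp
qed

lemma expectation_disjoint_triangles:
  assumes V: "{i, j, k, l, m, p} \<subseteq> V" and "distinct [i, j, k, l, m, p]"
  shows "expectation (\<lambda>\<omega>. triangle_product i j k \<omega> * triangle_product l m p \<omega>) = real d ^ 2"
proof -
  have "expectation (\<lambda>\<omega>. triangle_product i j k \<omega> * triangle_product l m p \<omega>)
      = expectation (triangle_product i j k) * expectation (triangle_product l m p)"
    using assms by (intro expectation_mult_disjoint[of "{1..d} \<times> {i, j, k}" _ "{1..d} \<times> {l, m, p}"])
      (auto intro!: poly_triangle_product)
  then show ?thesis using assms by (simp add: expectation_triangle_product power2_eq_square)
qed

end

section \<open>Means and variances of triangle sums\<close>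

text \<open>
  Intersections of size 3 are left out because increasing triples with the same three entries coincide.
\<close>
definition overlapping_pairs :: "(nat \<times> nat \<times> nat) set \<Rightarrow> ((nat \<times> nat \<times> nat) \<times> (nat \<times> nat \<times> nat)) set" where
  "overlapping_pairs C = {((i, j, k), (l, m, p)). (i, j, k) \<in> C \<and> (l, m, p) \<in> C \<and>
     card ({i, j, k} \<inter> {l, m, p}) \<in> {1, 2}}"

lemma intersect_cases_three:
  assumes A: "card A = 3" and B: "card B = 3"
  obtains (equal) "A = B"
  | (edge) x y z w where "A = {x, y, z}" "B = {x, y, w}" "distinct [x, y, z, w]" "card (A \<inter> B) = 2"
  | (vertex) x y z u w where "A = {x, y, z}" "B = {x, u, w}" "distinct [x, y, z, u, w]" "card (A \<inter> B) = 1"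
  | (disjoint) "A \<inter> B = {}"
proof -
  have fin: "finite A" "finite B" using A B by (auto intro: card_ge_0_finite)
  have "card (A \<inter> B) \<le> 3" using card_mono[of A "A \<inter> B"] fin A by auto
  then consider "card (A \<inter> B) = 3" | "card (A \<inter> B) = 2" | "card (A \<inter> B) = 1" | "card (A \<inter> B) = 0"
    by linarith
  then show ?thesis
  proof cases
    case 1
    then have "A \<inter> B = A" "A \<inter> B = B" using card_subset_eq[of A "A \<inter> B"] card_subset_eq[of B "A \<inter> B"] fin A B by auto
    then show ?thesis by (intro equal) auto
  next
    case 2
    then obtain x y where xy: "A \<inter> B = {x, y}" "x \<noteq> y" by (auto simp: card_2_iff)
    have "card (A - B) = 1" "card (B - A) = 1"
      using 2 A B card_Diff_subset_Int[of A B] card_Diff_subset_Int[of B A] fin by (auto simp: Int_commute)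
    then obtain z w where zw: "A - B = {z}" "B - A = {w}" by (auto simp: card_1_singleton_iff)
    have "A = {x, y, z}" "B = {x, y, w}" using xy zw by blast+
    moreover have "distinct [x, y, z, w]" using xy zw by auto
    ultimately show ?thesis using edge 2 by blast
  next
    case 3
    then obtain x where x: "A \<inter> B = {x}" by (auto simp: card_1_singleton_iff)
    have "card (A - B) = 2" "card (B - A) = 2"
      using 3 A B card_Diff_subset_Int[of A B] card_Diff_subset_Int[of B A] fin by (auto simp: Int_commute)
    then obtain y z u w where zw: "A - B = {y, z}" "y \<noteq> z" "B - A = {u, w}" "u \<noteq> w" by (auto simp: card_2_iff)
    have "A = {x, y, z}" "B = {x, u, w}" using x zw by blast+
    moreover have "distinct [x, y, z, u, w]" using x zw by auto
    ultimately show ?thesis using vertex 3 by blast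
  next
    case 4
    then show ?thesis using fin by (intro disjoint) auto
  qed
qed

context gaussian_columns begin

text \<open>
  Triangles are stored as increasing triples, while the moments above are stated for a convenient order of
  the vertices; the symmetry of the Gram matrix makes the order irrelevant.
\<close>
lemma triangle_product_cong:
  assumes "{i, j, k} = {x, y, z}" "distinct [i, j, k]" "distinct [x, y, z]"
  shows "triangle_product i j k = triangle_product x y z"
proof -
  have "i \<in> {x, y, z}" "j \<in> {x, y, z}" "k \<in> {x, y, z}" using assms(1) by blast+
  then have "(i = x \<and> j = y \<and> k = z) \<or> (i = x \<and> j = z \<and> k = y) \<or> (i = y \<and> j = x \<and> k = z) \<or>
      (i = y \<and> j = z \<and> k = x) \<or> (i = z \<and> j = x \<and> k = y) \<or> (i = z \<and> j = y \<and> k = x)"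
    using assms(2) by auto
  then show ?thesis
    by (elim disjE) (simp_all add: triangle_product_def fun_eq_iff gram_commute[of y x] gram_commute[of z x]
        gram_commute[of z y] mult_ac)
qed

text \<open>
  The term $d^2$ is the product of the two means. The rest bounds the covariance, where $1 \le d$ allows
  lower powers of $d$ to be absorbed: $d (d + 2) (d + 8) \le 27 d^3$ for equal triangles, and
  $3 d^2 + 6 d \le 9 d^2$ for a common edge, which also covers the excess $2 d$ of a common vertex.
\<close>
lemma expectation_triangle_products_le:
  assumes d: "d > 0" and V: "{i, j, k, l, m, p} \<subseteq> V" and ord: "i < j" "j < k" "l < m" "m < p"
  shows "expectation (\<lambda>\<omega>. triangle_product i j k \<omega> * triangle_product l m p \<omega>) \<le> real d ^ 2
      + 27 * real d ^ 3 * (if (i, j, k) = (l, m, p) then 1 else 0)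
      + 9 * real d ^ 2 * (if card ({i, j, k} \<inter> {l, m, p}) \<in> {1, 2} then 1 else 0)"
proof -
  have dist: "distinct [i, j, k]" "distinct [l, m, p]" using ord by auto
  have sq: "real d \<le> real d ^ 2" "real d ^ 2 \<le> real d ^ 3" 
    using d power_increasing[of 1 2 "real d"] power_increasing[of 2 3 "real d"] by auto
  have "card {i, j, k} = 3" "card {l, m, p} = 3" using dist by auto
  then show ?thesis
  proof (cases rule: intersect_cases_three)
    case equal
    then have "i \<in> {l, m, p}" "j \<in> {l, m, p}" "k \<in> {l, m, p}" by blast+
    then have eq: "i = l" "j = m" "k = p" using ord by auto
    have "expectation (\<lambda>\<omega>. triangle_product i j k \<omega> * triangle_product l m p \<omega>)
        = real d * (real d + 2) * (real d + 8)"
      using V dist unfolding eq by (intro expectation_triangle_product_square) auto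
    also have "\<dots> = real d ^ 3 + 10 * real d ^ 2 + 16 * real d"
      by (simp add: algebra_simps power2_eq_square power3_eq_cube)
    also have "\<dots> \<le> real d ^ 2 + 27 * real d ^ 3"
      using sq of_nat_0_le_iff[of d, where 'a = real] by linarith
    finally show ?thesis using dist by (simp add: eq)
  next
    case (edge x y z w)
    have "triangle_product i j k = triangle_product x y z" "triangle_product l m p = triangle_product x y w"
      using edge dist by (auto intro!: triangle_product_cong)
    moreover have "expectation (\<lambda>\<omega>. triangle_product x y z \<omega> * triangle_product x y w \<omega>) = 3 * real d ^ 2 + 6 * real d"
      using edge V by (intro expectation_triangles_sharing_edge) auto
    moreover have "0 \<le> 27 * real d ^ 3 * (if (i, j, k) = (l, m, p) then 1 else 0)" by simp
    moreover have "(if card ({i, j, k} \<inter> {l, m, p}) \<in> {1, 2} then 1 else 0) = (1 :: real)" using edge(4) by simp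
    ultimately show ?thesis using sq of_nat_0_le_iff[of d, where 'a = real]
      by (simp only: mult_1_right)
  next
    case (vertex x y z u w)
    have "triangle_product i j k = triangle_product x y z" "triangle_product l m p = triangle_product x u w"
      using vertex dist by (auto intro!: triangle_product_cong)
    moreover have "expectation (\<lambda>\<omega>. triangle_product x y z \<omega> * triangle_product x u w \<omega>) = real d ^ 2 + 2 * real d"
      using vertex V by (intro expectation_triangles_sharing_vertex) auto
    moreover have "0 \<le> 27 * real d ^ 3 * (if (i, j, k) = (l, m, p) then 1 else 0)" by simp
    moreover have "(if card ({i, j, k} \<inter> {l, m, p}) \<in> {1, 2} then 1 else 0) = (1 :: real)" using vertex(4) by simp
    ultimately show ?thesis using sq of_nat_0_le_iff[of d, where 'a = real]
      by (simp only: mult_1_right)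
  next
    case disjoint
    then have "expectation (\<lambda>\<omega>. triangle_product i j k \<omega> * triangle_product l m p \<omega>) = real d ^ 2"
      using V dist by (intro expectation_disjoint_triangles) auto
    then show ?thesis by simp
  qed
qed

definition triangle_sum :: "(nat \<times> nat \<times> nat) set \<Rightarrow> 'a \<Rightarrow> real" where
  "triangle_sum C \<omega> = (\<Sum>(i, j, k)\<in>C. triangle_product i j k \<omega>)"

lemma poly_triangle_sum:
  assumes "C \<subseteq> V \<times> V \<times> V"
  shows "col_poly V (triangle_sum C)"
  unfolding triangle_sum_def[abs_def] using assms
  by (intro poly_sum) (auto simp: case_prod_unfold intro!: poly_triangle_product)

lemma expectation_triangle_sum:
  assumes C: "C \<subseteq> V \<times> V \<times> V" and ord: "\<And>i j k. (i, j, k) \<in> C \<Longrightarrow> i < j \<and> j < k"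
  shows "expectation (triangle_sum C) = real d * real (card C)"
proof -
  have "expectation (triangle_sum C) = (\<Sum>t\<in>C. expectation (\<lambda>\<omega>. case t of (i, j, k) \<Rightarrow> triangle_product i j k \<omega>))"
    unfolding triangle_sum_def using C
    by (intro Bochner_Integration.integral_sum) (auto intro!: col_poly_integrable[of V] poly_triangle_product)
  also have "\<dots> = (\<Sum>t\<in>C. real d)"
  proof (intro sum.cong refl)
    fix t assume t: "t \<in> C"
    obtain i j k where eq: "t = (i, j, k)" by (metis prod_cases3)
    show "expectation (\<lambda>\<omega>. case t of (i, j, k) \<Rightarrow> triangle_product i j k \<omega>) = real d"
      using t C ord[of i j k] unfolding eq prod.case by (intro expectation_triangle_product) auto
  qed
  finally show ?thesis by simp
qed

lemma variance_triangle_sum_le: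
  assumes d: "d > 0" and fin: "finite C"
    and C: "C \<subseteq> V \<times> V \<times> V" and ord: "\<And>i j k. (i, j, k) \<in> C \<Longrightarrow> i < j \<and> j < k"
  shows "variance (triangle_sum C) \<le> 27 * real d ^ 3 * real (card C) + 9 * real d ^ 2 * real (card (overlapping_pairs C))"
proof -
  let ?F = "\<lambda>t \<omega>. case t of (i, j, k) \<Rightarrow> triangle_product i j k \<omega>"
  let ?O = "overlapping_pairs C"
  have poly: "col_poly V (?F t)" if "t \<in> C" for t
    using that C by (auto intro!: poly_triangle_product)
  have O: "?O \<subseteq> C \<times> C" by (auto simp: overlapping_pairs_def)
  have "expectation (\<lambda>\<omega>. (triangle_sum C \<omega>)\<^sup>2) = expectation (\<lambda>\<omega>. \<Sum>t\<in>C. \<Sum>t'\<in>C. ?F t \<omega> * ?F t' \<omega>)"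
    by (simp add: triangle_sum_def power2_eq_square sum_product)
  also have "\<dots> = (\<Sum>t\<in>C. \<Sum>t'\<in>C. expectation (\<lambda>\<omega>. ?F t \<omega> * ?F t' \<omega>))"
    using col_poly_integrable[OF poly_mult[OF poly poly]]
    by (simp only: Bochner_Integration.integral_sum Bochner_Integration.integrable_sum subset_refl cong: sum.cong)
  also have "\<dots> \<le> (\<Sum>t\<in>C. \<Sum>t'\<in>C. real d ^ 2 + 27 * real d ^ 3 * (if t = t' then 1 else 0)
      + 9 * real d ^ 2 * (if (t, t') \<in> ?O then 1 else 0))"
  proof (intro sum_mono)
    fix t t' assume t: "t \<in> C" "t' \<in> C"
    obtain i j k l m p where eq: "t = (i, j, k)" "t' = (l, m, p)" by (metis prod_cases3)
    have "{i, j, k, l, m, p} \<subseteq> V" "i < j" "j < k" "l < m" "m < p"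
      using t C ord[of i j k] ord[of l m p] unfolding eq by auto
    from expectation_triangle_products_le[OF d this]
    show "expectation (\<lambda>\<omega>. ?F t \<omega> * ?F t' \<omega>) \<le> real d ^ 2 + 27 * real d ^ 3 * (if t = t' then 1 else 0)
      + 9 * real d ^ 2 * (if (t, t') \<in> ?O then 1 else 0)"
      using t unfolding eq overlapping_pairs_def by simp
  qed
  also have "\<dots> = (real (card C))\<^sup>2 * real d ^ 2 + 27 * real d ^ 3 * (\<Sum>t\<in>C. \<Sum>t'\<in>C. if t = t' then 1 else 0)
      + 9 * real d ^ 2 * (\<Sum>t\<in>C. \<Sum>t'\<in>C. if (t, t') \<in> ?O then 1 else 0)"
    by (simp only: sum.distrib flip: sum_distrib_left) (simp add: power2_eq_square)
  also have "(\<Sum>t\<in>C. \<Sum>t'\<in>C. if t = t' then 1 else 0) = real (card C)"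
    using fin by simp
  also have "(\<Sum>t\<in>C. \<Sum>t'\<in>C. if (t, t') \<in> ?O then 1 else 0) = real (card ?O)"
  proof -
    have "(\<Sum>t\<in>C. \<Sum>t'\<in>C. if (t, t') \<in> ?O then 1 else 0) = (\<Sum>q\<in>C \<times> C. if q \<in> ?O then 1 else (0::real))"
      by (simp add: sum.cartesian_product)
    also have "\<dots> = real (card (C \<times> C \<inter> ?O))"
      using fin by (simp add: sum.If_cases Int_def)
    also have "C \<times> C \<inter> ?O = ?O" using O by auto
    finally show ?thesis .
  qed
  finally have second: "expectation (\<lambda>\<omega>. (triangle_sum C \<omega>)\<^sup>2) \<le> (real (card C))\<^sup>2 * real d ^ 2
      + 27 * real d ^ 3 * real (card C) + 9 * real d ^ 2 * real (card ?O)" .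
  have "variance (triangle_sum C) = expectation (\<lambda>\<omega>. (triangle_sum C \<omega>)\<^sup>2) - (expectation (triangle_sum C))\<^sup>2"
    using C by (intro variance_eq col_poly_integrable[of V] poly_power poly_triangle_sum) auto
  then show ?thesis
    using second expectation_triangle_sum[OF C ord] by (simp add: power_mult_distrib mult.commute)
qed

end

text \<open>
  The cross terms vanish because two different triangles cannot have the same edges, so some variable
  occurs exactly once in their product.
\<close>
lemma second_moment_edge_triangles:
  fixes C :: "(nat \<times> nat \<times> nat) set"
  assumes "gaussian_family M I \<xi>" and fin: "finite C"
    and C: "\<And>i j k. (i, j, k) \<in> C \<Longrightarrow> i < j \<and> j < k \<and> {(i, j), (j, k), (i, k)} \<subseteq> I"
  shows "integrable M (\<lambda>\<omega>. (\<Sum>(i, j, k)\<in>C. \<xi> (i, j) \<omega> * \<xi> (j, k) \<omega> * \<xi> (i, k) \<omega>)\<^sup>2)" (is ?int)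
    and "integral\<^sup>L M (\<lambda>\<omega>. (\<Sum>(i, j, k)\<in>C. \<xi> (i, j) \<omega> * \<xi> (j, k) \<omega> * \<xi> (i, k) \<omega>)\<^sup>2) = real (card C)" (is ?eq)
proof -
  interpret gaussian_family M I \<xi> by fact
  let ?F = "\<lambda>t \<omega>. case t of (i, j, k) \<Rightarrow> \<xi> (i, j) \<omega> * \<xi> (j, k) \<omega> * \<xi> (i, k) \<omega>"
  have poly: "poly_in I (?F t)" if "t \<in> C" for t
  proof -
    obtain i j k where eq: "t = (i, j, k)" by (metis prod_cases3)
    then show ?thesis using that C[of i j k] by (auto intro!: poly_intros)
  qed
  show ?int
    by (intro poly_integrable[of I] poly_power poly_sum poly) auto
  have square: "expectation (\<lambda>\<omega>. ?F t \<omega> * ?F t \<omega>) = 1" if t: "t \<in> C" for t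
  proof -
    obtain i j k where eq: "t = (i, j, k)" by (metis prod_cases3)
    have I: "i < j" "j < k" "(i, j) \<in> I" "(j, k) \<in> I" "(i, k) \<in> I" using C[of i j k] t eq by auto
    have "expectation (\<lambda>\<omega>. ?F t \<omega> * ?F t \<omega>)
        = expectation (\<lambda>\<omega>. (\<xi> (i, j) \<omega>)\<^sup>2 * ((\<xi> (j, k) \<omega>)\<^sup>2 * (\<xi> (i, k) \<omega>)\<^sup>2))"
      by (simp add: eq power2_eq_square mult_ac)
    also have "\<dots> = expectation (\<lambda>\<omega>. (\<xi> (i, j) \<omega>)\<^sup>2) * expectation (\<lambda>\<omega>. (\<xi> (j, k) \<omega>)\<^sup>2 * (\<xi> (i, k) \<omega>)\<^sup>2)"
      using I by (intro expectation_mult_disjoint[of "{(i, j)}" _ "{(j, k), (i, k)}"]) (auto intro!: poly_intros)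
    also have "\<dots> = 1"
      using I by (simp add: moment_2 expectation_two_squares)
    finally show ?thesis .
  qed
  have cross: "expectation (\<lambda>\<omega>. ?F t \<omega> * ?F t' \<omega>) = 0" if t: "t \<in> C" "t' \<in> C" "t \<noteq> t'" for t t'
  proof -
    obtain i j k l m p where eq: "t = (i, j, k)" "t' = (l, m, p)" by (metis prod_cases3)
    have ord: "i < j" "j < k" "l < m" "m < p"
      and I: "(i, j) \<in> I" "(j, k) \<in> I" "(i, k) \<in> I" "(l, m) \<in> I" "(m, p) \<in> I" "(l, p) \<in> I"
      using C[of i j k] C[of l m p] t eq by auto
    have lone: "expectation (\<lambda>\<omega>. \<xi> e \<omega> * (\<xi> f \<omega> * \<xi> g \<omega> * (\<xi> (l, m) \<omega> * \<xi> (m, p) \<omega> * \<xi> (l, p) \<omega>))) = 0"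
      if "e \<in> I" "f \<in> I" "g \<in> I" "e \<notin> {f, g, (l, m), (m, p), (l, p)}" for e f g
      using that I by (intro expectation_lone_variable[of _ "{f, g, (l, m), (m, p), (l, p)}"]) (auto intro!: poly_intros)
    \<comment> \<open>Along an increasing triple, the two short edges already determine the triangle.\<close>
    have "(i, j) \<notin> {(l, m), (m, p), (l, p)} \<or> (j, k) \<notin> {(l, m), (m, p), (l, p)}"
      using t(3) ord unfolding eq by auto
    then consider "(i, j) \<notin> {(l, m), (m, p), (l, p)}" | "(j, k) \<notin> {(l, m), (m, p), (l, p)}"
      by blast
    then show ?thesis
    proof cases
      case 1
      then show ?thesis using lone[of "(i, j)" "(j, k)" "(i, k)"] ord I by (simp add: eq mult_ac)
    next
      case 2
      then show ?thesis using lone[of "(j, k)" "(i, j)" "(i, k)"] ord I by (simp add: eq mult_ac)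
    qed
  qed
  have "expectation (\<lambda>\<omega>. (\<Sum>t\<in>C. ?F t \<omega>)\<^sup>2) = expectation (\<lambda>\<omega>. \<Sum>t\<in>C. \<Sum>t'\<in>C. ?F t \<omega> * ?F t' \<omega>)"
    by (simp add: power2_eq_square sum_product)
  also have "\<dots> = (\<Sum>t\<in>C. \<Sum>t'\<in>C. expectation (\<lambda>\<omega>. ?F t \<omega> * ?F t' \<omega>))"
    using poly_integrable[OF poly_mult[OF poly poly]]
    by (simp only: Bochner_Integration.integral_sum Bochner_Integration.integrable_sum subset_refl cong: sum.cong)
  also have "\<dots> = (\<Sum>t\<in>C. \<Sum>t'\<in>C. if t = t' then 1 else 0)"
    using square cross by (intro sum.cong refl) auto
  also have "\<dots> = real (card C)" using fin by simp
  finally show ?eq .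
qed

section \<open>Gaussian product measures\<close>

text \<open>
  Only the coordinates in \<open>I\<close> have to be standard Gaussian. The product may have more factors, such as
  the diagonal of a GOE matrix with its variance 2.
\<close>
lemma gaussian_family_PiM:
  assumes \<mu>: "\<And>p. p \<in> I \<Longrightarrow> \<mu> p = gaussian 0 1" and prob: "\<And>p. p \<in> J \<Longrightarrow> prob_space (\<mu> p)"
    and IJ: "I \<subseteq> J"
  shows "gaussian_family (PiM J \<mu>) I (\<lambda>p \<omega>. \<omega> p)"
proof -
  interpret P: prob_space "PiM J \<mu>" by (rule prob_space_PiM[OF prob])
  have law: "distr (PiM J \<mu>) (\<mu> p) (\<lambda>\<omega>. \<omega> p) = \<mu> p" if "p \<in> J" for p
    using that prob by (intro distr_PiM_component)
  have sets_\<mu>: "sets (\<mu> p) = sets borel" if "p \<in> I" for p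
    using \<mu>[OF that] by (simp add: gaussian_def)
  have comp: "(\<lambda>\<omega>. \<omega> p) \<in> measurable (PiM J \<mu>) (\<mu> p)" if "p \<in> J" for p
    using that by (rule measurable_component_singleton)
  have comp': "(\<lambda>\<omega>. \<omega> p) \<in> measurable (PiM J \<mu>) borel" if "p \<in> I" for p
    using comp[of p] IJ that measurable_cong_sets[OF refl sets_\<mu>[OF that]] by blast
  have moment: "has_bochner_integral (PiM J \<mu>) (\<lambda>\<omega>. \<omega> p ^ m) c"
    if p: "p \<in> I" and c: "has_bochner_integral lborel (\<lambda>x. std_normal_density x * x ^ m) c" for p m c
  proof -
    have pow: "(\<lambda>x. x ^ m) \<in> borel_measurable (\<mu> p)"
      by (simp add: measurable_cong_sets[OF sets_\<mu>[OF p] refl])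
    have "has_bochner_integral (gaussian 0 1) (\<lambda>x. x ^ m) c"
      unfolding gaussian_def using c
      by (subst has_bochner_integral_density) (auto simp: real_scaleR_def)
    then have "has_bochner_integral (distr (PiM J \<mu>) (\<mu> p) (\<lambda>\<omega>. \<omega> p)) (\<lambda>x. x ^ m) c"
      using law[of p] p IJ \<mu>[OF p] by auto
    then show ?thesis
      unfolding has_bochner_integral_iff using comp[of p] p IJ pow
      by (simp add: subset_iff integrable_distr_eq integral_distr)
  qed
  show ?thesis
  proof (unfold_locales)
    have ind: "P.indep_vars \<mu> (\<lambda>p \<omega>. \<omega> p) J"
    proof (cases "J = {}")
      case False
      have "distr (PiM J \<mu>) (PiM J \<mu>) (\<lambda>\<omega>. \<lambda>p\<in>J. \<omega> p) = distr (PiM J \<mu>) (PiM J \<mu>) (\<lambda>\<omega>. \<omega>)"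
        by (intro distr_cong refl) (auto simp: space_PiM)
      also have "\<dots> = PiM J (\<lambda>p. distr (PiM J \<mu>) (\<mu> p) (\<lambda>\<omega>. \<omega> p))"
        by (simp only: distr_id2) (intro PiM_cong refl law[symmetric])
      finally show ?thesis using False comp by (subst P.indep_vars_iff_distr_eq_PiM') auto
    next
      case True
      show ?thesis unfolding P.indep_vars_def P.indep_sets_def by (simp add: True)
    qed
    have "P.indep_vars \<mu> (\<lambda>p \<omega>. \<omega> p) I"
      using ind IJ by (rule P.indep_vars_subset)
    then show "P.indep_vars (\<lambda>_. borel) (\<lambda>p \<omega>. \<omega> p) I"
      unfolding P.indep_vars_def2 using comp' by (simp add: sets_\<mu> cong: P.indep_sets_cong)
  next
    fix p and m :: nat assume p: "p \<in> I"
    have "integrable lborel (\<lambda>x. std_normal_density x * x ^ m)"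
      using integrable_normal_moment[of 1 0 m] by simp
    then obtain c where "has_bochner_integral lborel (\<lambda>x. std_normal_density x * x ^ m) c"
      by (auto simp: integrable.simps)
    from moment[OF p this] show "integrable (PiM J \<mu>) (\<lambda>\<omega>. \<omega> p ^ m)" by (rule integrable.intros)
  next
    fix p assume p: "p \<in> I"
    show "P.expectation (\<lambda>\<omega>. \<omega> p) = 0"
      using moment[OF p, of 1 0] std_normal_moment_odd[of 0] by (simp add: has_bochner_integral_iff)
    show "P.expectation (\<lambda>\<omega>. (\<omega> p)\<^sup>2) = 1"
      using moment[OF p, of 2 1] std_normal_moment_even[of 1] by (simp add: has_bochner_integral_iff)
    show "P.expectation (\<lambda>\<omega>. \<omega> p ^ 4) = 3"
      using moment[OF p, of 4 3] std_normal_moment_even[of 2] by (simp add: has_bochner_integral_iff fact_numeral)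
  qed
qed

lemma prob_space_gaussian: "v > 0 \<Longrightarrow> prob_space (gaussian m v)"
  by (simp add: gaussian_def prob_space_normal_density)

lemma sets_gaussian [measurable_cong, simp]: "sets (gaussian m v) = sets borel"
  by (simp add: gaussian_def)

lemma gaussian_columns_gaussian_matrix:
  "gaussian_columns (gaussian_matrix d n) d {1..n} (\<lambda>p X. X p)"
  unfolding gaussian_columns_def gaussian_matrix_def
  by (rule gaussian_family_PiM) (auto intro: prob_space_gaussian)

text \<open>
  The law of the independent entries from which \<open>goe\<close> is reflected.
\<close>
abbreviation upper_entries :: "nat \<Rightarrow> (nat \<times> nat \<Rightarrow> real) measure" where
  "upper_entries n \<equiv> Pi\<^sub>M {(i, j). 1 \<le> i \<and> i \<le> j \<and> j \<le> n} (\<lambda>(i, j). gaussian 0 (if i = j then 2 else 1))"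

lemma gaussian_family_upper_entries:
  "gaussian_family (upper_entries n) {(i, j). 1 \<le> i \<and> i < j \<and> j \<le> n} (\<lambda>p Y. Y p)"
  by (rule gaussian_family_PiM) (auto intro: prob_space_gaussian)

section \<open>Total variation\<close>

lemma total_variation_ge:
  assumes "prob_space \<mu>" "prob_space \<nu>" "A \<in> sets \<mu>"
  shows "\<bar>measure \<mu> A - measure \<nu> A\<bar> \<le> total_variation \<mu> \<nu>"
  unfolding total_variation_def
proof (rule cSUP_upper[OF assms(3)], rule bdd_aboveI2)
  fix B
  show "\<bar>measure \<mu> B - measure \<nu> B\<bar> \<le> 1"
    using prob_space.prob_le_1[OF assms(1), of B] prob_space.prob_le_1[OF assms(2), of B]
      measure_nonneg[of \<mu> B] measure_nonneg[of \<nu> B] by linarith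
qed

lemma total_variation_le_1:
  assumes "prob_space \<mu>" "prob_space \<nu>"
  shows "total_variation \<mu> \<nu> \<le> 1"
  unfolding total_variation_def
proof (rule cSUP_least)
  show "sets \<mu> \<noteq> {}" by blast
  fix B
  show "\<bar>measure \<mu> B - measure \<nu> B\<bar> \<le> 1"
    using prob_space.prob_le_1[OF assms(1), of B] prob_space.prob_le_1[OF assms(2), of B]
      measure_nonneg[of \<mu> B] measure_nonneg[of \<nu> B] by linarith
qed

text \<open>
  An event of the image pulls back to an event of the source, which separates the two measures equally well.
\<close>
lemma total_variation_distr_le:
  assumes "prob_space \<mu>" "prob_space \<nu>" and sets: "sets \<mu> = sets \<nu>" and f: "f \<in> measurable \<mu> N"
  shows "total_variation (distr \<mu> N f) (distr \<nu> N f) \<le> total_variation \<mu> \<nu>"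
proof -
  have f': "f \<in> measurable \<nu> N" using f measurable_cong_sets[OF sets refl] by blast
  have "\<bar>measure (distr \<mu> N f) A - measure (distr \<nu> N f) A\<bar> \<le> total_variation \<mu> \<nu>" if "A \<in> sets N" for A
  proof -
    have "f -` A \<inter> space \<mu> \<in> sets \<mu>" using f that by (rule measurable_sets)
    then show ?thesis
      using total_variation_ge[OF assms(1,2), of "f -` A \<inter> space \<mu>"] f f' that sets_eq_imp_space_eq[OF sets]
      by (simp add: measure_distr)
  qed
  then show ?thesis
    unfolding total_variation_def[of "distr \<mu> N f"] by (intro cSUP_least) auto
qed

section \<open>The laws of the triangle statistic\<close>

lemma wishart_map_measurable:
  "(\<lambda>X. \<lambda>(i, j)\<in>{1..n} \<times> {1..n}.
        ((\<Sum>k=1..d. X (k, i) * X (k, j)) - real d * (if i = j then 1 else 0)) / sqrt (real d))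
    \<in> measurable (gaussian_matrix d n) (matrix_space n)"
proof -
  have X: "(\<lambda>X. X p) \<in> borel_measurable (gaussian_matrix d n)" if "p \<in> {1..d} \<times> {1..n}" for p
  proof -
    have "(\<lambda>X. X p) \<in> measurable (gaussian_matrix d n) (gaussian 0 1)"
      unfolding gaussian_matrix_def using that by (rule measurable_component_singleton)
    then show ?thesis by (simp cong: measurable_cong_sets)
  qed
  show ?thesis
    unfolding matrix_space_def
  proof (rule measurable_restrict)
    fix q assume q: "q \<in> {1..n} \<times> {1..n}"
    obtain i j where ij: "q = (i, j)" by (cases q)
    have "(\<lambda>X. X (k, i)) \<in> borel_measurable (gaussian_matrix d n)"
      "(\<lambda>X. X (k, j)) \<in> borel_measurable (gaussian_matrix d n)" if "k \<in> {1..d}" for k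
      using that q ij by (auto intro!: X)
    then show "(\<lambda>X. case q of (i, j) \<Rightarrow> ((\<Sum>k=1..d. X (k, i) * X (k, j)) - real d * (if i = j then 1 else 0)) / sqrt (real d))
        \<in> borel_measurable (gaussian_matrix d n)"
      unfolding ij prod.case
      by (intro borel_measurable_divide borel_measurable_diff borel_measurable_sum borel_measurable_times
          borel_measurable_const) auto
  qed
qed

lemma goe_map_measurable:
  "(\<lambda>Y. \<lambda>(i, j)\<in>{1..n} \<times> {1..n}. Y (min i j, max i j)) \<in> measurable (upper_entries n) (matrix_space n)"
  unfolding matrix_space_def
proof (rule measurable_restrict)
  fix q assume q: "q \<in> {1..n} \<times> {1..n}"
  obtain i j where ij: "q = (i, j)" by (cases q)
  have "(\<lambda>Y. Y (min i j, max i j)) \<in> measurable (upper_entries n) (case (min i j, max i j) of (i, j) \<Rightarrow> gaussian 0 (if i = j then 2 else 1))"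
    using q ij by (intro measurable_component_singleton) auto
  then show "(\<lambda>Y. case q of (i, j) \<Rightarrow> Y (min i j, max i j)) \<in> borel_measurable (upper_entries n)"
    unfolding ij prod.case by (simp cong: measurable_cong_sets)
qed

lemma schur_product_measurable: "schur_product n A \<in> measurable (matrix_space n) (matrix_space n)"
  unfolding schur_product_def[abs_def] matrix_space_def by measurable

lemma C3_D:
  assumes "simple_graph G" "verts G = {1..n}" "(i, j, k) \<in> C3 G"
  shows "i < j" "j < k" "i \<in> {1..n}" "j \<in> {1..n}" "k \<in> {1..n}"
    "{i, j} \<in> edges G" "{j, k} \<in> edges G" "{k, i} \<in> edges G"
  using assms by (fastforce simp: C3_def simple_graph_def)+

lemma C3_subset:
  assumes "simple_graph G" "verts G = {1..n}"
  shows "C3 G \<subseteq> {1..n} \<times> {1..n} \<times> {1..n}"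
  using C3_D[OF assms] by auto

lemma finite_C3: "simple_graph G \<Longrightarrow> verts G = {1..n} \<Longrightarrow> finite (C3 G)"
  by (rule finite_subset[OF C3_subset]) auto

lemma kappa3_measurable:
  assumes "simple_graph G" "verts G = {1..n}"
  shows "kappa3 G \<in> borel_measurable (matrix_space n)"
proof -
  have "(\<lambda>M. case t of (i, j, k) \<Rightarrow> M (i, j) * M (j, k) * M (k, i)) \<in> borel_measurable (matrix_space n)"
    if t: "t \<in> C3 G" for t
  proof -
    obtain i j k where eq: "t = (i, j, k)" by (metis prod_cases3)
    have *: "(\<lambda>M. M p) \<in> borel_measurable (matrix_space n)" if "p \<in> {1..n} \<times> {1..n}" for p
      unfolding matrix_space_def using that by (rule measurable_component_singleton)
    show ?thesis unfolding eq prod.case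
      using C3_D[OF assms, of i j k] t eq by (intro borel_measurable_times *) auto
  qed
  then show ?thesis unfolding kappa3_def[abs_def] by (intro borel_measurable_sum) auto
qed

lemma prob_space_masked_wishart: "prob_space (masked_wishart n G d)"
proof -
  interpret gaussian_columns "gaussian_matrix d n" d "{1..n}" "\<lambda>p X. X p"
    by (rule gaussian_columns_gaussian_matrix)
  have "prob_space (wishart n d)"
    unfolding wishart_def by (rule prob_space_distr[OF wishart_map_measurable])
  then show ?thesis unfolding masked_wishart_def masked_def
    by (rule prob_space.prob_space_distr) (simp add: wishart_def schur_product_measurable)
qed

lemma prob_space_masked_goe: "prob_space (masked_goe n G)"
proof -
  interpret gaussian_family "upper_entries n" "{(i, j). 1 \<le> i \<and> i < j \<and> j \<le> n}" "\<lambda>p Y. Y p"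
    by (rule gaussian_family_upper_entries)
  have "prob_space (goe n)"
    unfolding goe_def by (rule prob_space_distr[OF goe_map_measurable])
  then show ?thesis unfolding masked_goe_def masked_def
    by (rule prob_space.prob_space_distr) (simp add: goe_def schur_product_measurable)
qed

text \<open>
  The mask equals 1 on every entry that the statistic reads, since these entries belong to edges.
\<close>
lemma kappa3_schur_product:
  assumes "simple_graph G" "verts G = {1..n}"
  shows "kappa3 G (schur_product n (adjacency G) M) = kappa3 G M"
  unfolding kappa3_def
proof (intro sum.cong refl, clarify)
  fix i j k assume t: "(i, j, k) \<in> C3 G"
  note D = C3_D[OF assms t]
  show "schur_product n (adjacency G) M (i, j) * schur_product n (adjacency G) M (j, k) *
      schur_product n (adjacency G) M (k, i) = M (i, j) * M (j, k) * M (k, i)"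
    using D by (simp add: schur_product_def adjacency_def)
qed

lemma kappa3_law_masked_wishart:
  assumes G: "simple_graph G" "verts G = {1..n}" and d: "d > 0"
  shows "kappa3_law G (masked_wishart n G d) = distr (gaussian_matrix d n) borel
    (\<lambda>X. gaussian_columns.triangle_sum d (\<lambda>p X. X p) (C3 G) X / sqrt (real d) ^ 3)"
proof -
  interpret gaussian_columns "gaussian_matrix d n" d "{1..n}" "\<lambda>p X. X p"
    by (rule gaussian_columns_gaussian_matrix)
  let ?W = "\<lambda>X::nat \<times> nat \<Rightarrow> real. \<lambda>(i, j)\<in>{1..n} \<times> {1..n}.
        ((\<Sum>k=1..d. X (k, i) * X (k, j)) - real d * (if i = j then 1 else 0)) / sqrt (real d)"
  have "kappa3 G (?W X) = triangle_sum (C3 G) X / sqrt (real d) ^ 3" for X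
  proof -
    have "(case t of (i, j, k) \<Rightarrow> ?W X (i, j) * ?W X (j, k) * ?W X (k, i))
        = (case t of (i, j, k) \<Rightarrow> triangle_product i j k X) / sqrt (real d) ^ 3" if "t \<in> C3 G" for t
    proof -
      obtain i j k where eq: "t = (i, j, k)" by (metis prod_cases3)
      note D = C3_D[OF G that[unfolded eq]]
      have W: "?W X (i, j) = gram i j X / sqrt (real d)" if "i \<in> {1..n}" "j \<in> {1..n}" "i \<noteq> j" for i j
        using that by (simp add: gram_def)
      have "?W X (i, j) = gram i j X / sqrt (real d)" "?W X (j, k) = gram j k X / sqrt (real d)"
        "?W X (k, i) = gram k i X / sqrt (real d)" using D by (intro W; simp)+
      then show ?thesis unfolding eq prod.case triangle_product_def
        by (simp only:) (simp add: power3_eq_cube)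
    qed
    then show ?thesis unfolding kappa3_def triangle_sum_def sum_divide_distrib
      by (intro sum.cong refl)
  qed
  then have eq: "kappa3 G \<circ> schur_product n (adjacency G) \<circ> ?W = (\<lambda>X. triangle_sum (C3 G) X / sqrt (real d) ^ 3)"
    by (simp add: fun_eq_iff kappa3_schur_product[OF G])
  have m1: "schur_product n (adjacency G) \<circ> ?W \<in> measurable (gaussian_matrix d n) (matrix_space n)"
    by (rule measurable_comp[OF wishart_map_measurable schur_product_measurable])
  have "kappa3_law G (masked_wishart n G d) = distr (gaussian_matrix d n) borel (kappa3 G \<circ> (schur_product n (adjacency G) \<circ> ?W))"
    unfolding kappa3_law_def masked_wishart_def masked_def wishart_def
    by (simp only: distr_distr[OF schur_product_measurable wishart_map_measurable]
        distr_distr[OF kappa3_measurable[OF G] m1])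
  then show ?thesis using eq by (simp add: comp_assoc)
qed

lemma kappa3_law_masked_goe:
  assumes G: "simple_graph G" "verts G = {1..n}"
  shows "kappa3_law G (masked_goe n G) = distr (upper_entries n) borel
    (\<lambda>Y. \<Sum>(i, j, k)\<in>C3 G. Y (i, j) * Y (j, k) * Y (i, k))"
proof -
  let ?M = "\<lambda>Y::nat \<times> nat \<Rightarrow> real. \<lambda>(i, j)\<in>{1..n} \<times> {1..n}. Y (min i j, max i j)"
  have "kappa3 G (?M Y) = (\<Sum>(i, j, k)\<in>C3 G. Y (i, j) * Y (j, k) * Y (i, k))" for Y
    unfolding kappa3_def
  proof (intro sum.cong refl, clarify)
    fix i j k assume "(i, j, k) \<in> C3 G"
    note D = C3_D[OF G this]
    show "?M Y (i, j) * ?M Y (j, k) * ?M Y (k, i) = Y (i, j) * Y (j, k) * Y (i, k)"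
      using D by (simp add: min_def max_def)
  qed
  then have eq: "kappa3 G \<circ> schur_product n (adjacency G) \<circ> ?M = (\<lambda>Y. \<Sum>(i, j, k)\<in>C3 G. Y (i, j) * Y (j, k) * Y (i, k))"
    by (simp add: fun_eq_iff kappa3_schur_product[OF G])
  have m1: "schur_product n (adjacency G) \<circ> ?M \<in> measurable (upper_entries n) (matrix_space n)"
    by (rule measurable_comp[OF goe_map_measurable schur_product_measurable])
  have "kappa3_law G (masked_goe n G) = distr (upper_entries n) borel (kappa3 G \<circ> (schur_product n (adjacency G) \<circ> ?M))"
    unfolding kappa3_law_def masked_goe_def masked_def goe_def
    by (simp only: distr_distr[OF schur_product_measurable goe_map_measurable]
        distr_distr[OF kappa3_measurable[OF G] m1])
  then show ?thesis using eq by (simp add: comp_assoc)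
qed

text \<open>
  The separating event is that the statistic is at least \<open>s\<close>, the midpoint between the two means $0$ and $T / \sqrt d$. Under
  the GOE this is unlikely by the second moment bound, which gives $T / s^2 = 4 d / T$. Under the Wishart
  law it fails only if the unnormalised triangle sum deviates by $d T / 2$ from its mean $d T$, and
  Chebyshev's inequality bounds this by $108 d / T + 36 P / T^2$.
\<close>
lemma total_variation_kappa3_ge:
  assumes G: "simple_graph G" "verts G = {1..n}" and d: "d > 0" and C: "C3 G \<noteq> {}"
  defines "T \<equiv> real (card (C3 G))" and "P \<equiv> real (card (overlapping_pairs (C3 G)))"
  shows "total_variation (kappa3_law G (masked_wishart n G d)) (kappa3_law G (masked_goe n G))
    \<ge> 1 - (112 * (real d / T) + 36 * (P / T\<^sup>2))"
proof -
  have T: "T > 0" using C finite_C3[OF G] by (simp add: T_def card_gt_0_iff)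
  define s where "s = T / (2 * sqrt (real d))"
  have s: "s > 0" using T d by (simp add: s_def)
  have sqrt_d: "sqrt (real d) > 0" "sqrt (real d) ^ 2 = real d" using d by auto
  let ?W = "kappa3_law G (masked_wishart n G d)" and ?M = "kappa3_law G (masked_goe n G)"

  have goe: "measure ?M {s..} \<le> 4 * (real d / T)"
  proof -
    interpret gaussian_family "upper_entries n" "{(i, j). 1 \<le> i \<and> i < j \<and> j \<le> n}" "\<lambda>p Y. Y p"
      by (rule gaussian_family_upper_entries)
    let ?f = "\<lambda>Y :: nat \<times> nat \<Rightarrow> real. \<Sum>(i, j, k)\<in>C3 G. Y (i, j) * Y (j, k) * Y (i, k)"
    have "i < j \<and> j < k \<and> {(i, j), (j, k), (i, k)} \<subseteq> {(i, j). 1 \<le> i \<and> i < j \<and> j \<le> n}"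
      if "(i, j, k) \<in> C3 G" for i j k
      using C3_D[OF G that] by auto
    note m = second_moment_edge_triangles[OF gaussian_family_axioms finite_C3[OF G] this]
    have meas: "?f \<in> borel_measurable (upper_entries n)"
    proof (rule poly_measurable)
      show "poly_in {(i, j). 1 \<le> i \<and> i < j \<and> j \<le> n} ?f"
        using C3_D[OF G] by (intro poly_sum) (fastforce intro!: poly_mult poly_var)
    qed simp
    have "measure ?M {s..} = prob (?f -` {s..} \<inter> space (upper_entries n))"
      unfolding kappa3_law_masked_goe[OF G] using meas by (intro measure_distr) auto
    also have "\<dots> \<le> prob {Y \<in> space (upper_entries n). s \<le> \<bar>?f Y\<bar>}"
      using meas by (intro finite_measure_mono) auto
    also have "\<dots> \<le> expectation (\<lambda>Y. (?f Y)\<^sup>2) / s\<^sup>2"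
      using meas m(1) s by (intro second_moment_method) auto
    also have "expectation (\<lambda>Y. (?f Y)\<^sup>2) = T"
      using m(2) by (simp add: T_def)
    also have "T / s\<^sup>2 = 4 * (real d / T)"
      using T sqrt_d by (simp add: s_def power_divide power_mult_distrib power2_eq_square)
    finally show ?thesis .
  qed

  have wishart: "1 - (108 * (real d / T) + 36 * (P / T\<^sup>2)) \<le> measure ?W {s..}"
  proof -
    interpret gaussian_columns "gaussian_matrix d n" d "{1..n}" "\<lambda>p X. X p"
      by (rule gaussian_columns_gaussian_matrix)
    let ?M = "gaussian_matrix d n" and ?F = "triangle_sum (C3 G)"
    have ord: "\<And>i j k. (i, j, k) \<in> C3 G \<Longrightarrow> i < j \<and> j < k" using C3_D[OF G] by blast
    note sub = C3_subset[OF G]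
    have meas: "?F \<in> borel_measurable ?M"
      by (rule poly_measurable[OF poly_triangle_sum[OF sub]]) simp
    have mean: "expectation ?F = real d * T"
      unfolding T_def by (rule expectation_triangle_sum[OF sub ord])
    let ?B = "{X \<in> space ?M. real d * T / 2 \<le> \<bar>?F X - expectation ?F\<bar>}"
    have B: "?B \<in> events" using meas by measurable
    have "prob ?B \<le> variance ?F / (real d * T / 2)\<^sup>2"
      using meas d T sub
      by (intro Chebyshev_inequality col_poly_integrable[of "{1..n}"] poly_power poly_triangle_sum) auto
    also have "\<dots> \<le> (27 * real d ^ 3 * T + 9 * real d ^ 2 * P) / (real d * T / 2)\<^sup>2"
      using variance_triangle_sum_le[OF d finite_C3[OF G] sub ord] by (intro divide_right_mono) (auto simp: T_def P_def)
    also have "\<dots> = 108 * (real d / T) + 36 * (P / T\<^sup>2)"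
      using d T by (simp add: field_simps power2_eq_square power3_eq_cube)
    finally have B_le: "prob ?B \<le> 108 * (real d / T) + 36 * (P / T\<^sup>2)" .
    have "space ?M - ?B \<subseteq> (\<lambda>X. ?F X / sqrt (real d) ^ 3) -` {s..} \<inter> space ?M"
    proof
      fix X assume "X \<in> space ?M - ?B"
      then have X: "X \<in> space ?M" and "\<not> real d * T / 2 \<le> \<bar>?F X - expectation ?F\<bar>" by auto
      then have "real d * T / 2 \<le> ?F X" 
        using mult_pos_pos[of "real d" T] d T unfolding mean by linarith
      then have "real d * T / 2 / sqrt (real d) ^ 3 \<le> ?F X / sqrt (real d) ^ 3"
        using sqrt_d by (intro divide_right_mono) auto
      moreover have "real d * T / 2 / sqrt (real d) ^ 3 = s"
        using sqrt_d d by (simp add: s_def power3_eq_cube power2_eq_square field_simps)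
      ultimately show "X \<in> (\<lambda>X. ?F X / sqrt (real d) ^ 3) -` {s..} \<inter> space ?M" using X by simp
    qed
    then have "prob (space ?M - ?B) \<le> prob ((\<lambda>X. ?F X / sqrt (real d) ^ 3) -` {s..} \<inter> space ?M)"
      using meas by (intro finite_measure_mono) auto
    also have "\<dots> = measure ?W {s..}"
      unfolding kappa3_law_masked_wishart[OF G d] using meas by (intro measure_distr[symmetric]) auto
    finally show ?thesis using B_le prob_compl[OF B] by linarith
  qed

  have prob: "prob_space ?W" "prob_space ?M"
  proof -
    show "prob_space ?W"
      unfolding kappa3_law_def
      by (rule prob_space.prob_space_distr[OF prob_space_masked_wishart])
        (simp add: masked_wishart_def masked_def kappa3_measurable[OF G])
    show "prob_space ?M"
      unfolding kappa3_law_def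
      by (rule prob_space.prob_space_distr[OF prob_space_masked_goe])
        (simp add: masked_goe_def masked_def kappa3_measurable[OF G])
  qed
  have "\<bar>measure ?W {s..} - measure ?M {s..}\<bar> \<le> total_variation ?W ?M"
    by (rule total_variation_ge[OF prob]) (simp add: kappa3_law_def)
  then show ?thesis using goe wishart by linarith
qed

section \<open>Counting overlapping triangles\<close>

lemma finite_subgraphs:
  assumes "simple_graph G"
  shows "finite {S. is_subgraph S G \<and> graph_iso S H}"
proof (rule finite_subset)
  show "{S. is_subgraph S G \<and> graph_iso S H} \<subseteq> Pow (verts G) \<times> Pow (Pow (verts G))"
    using assms by (fastforce simp: is_subgraph_def simple_graph_def)
  show "finite (Pow (verts G) \<times> Pow (Pow (verts G)))"
    using assms by (simp add: simple_graph_def)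
qed

text \<open>
  This description of the edges of a triangle does not depend on the order of its vertices.
\<close>
lemma triangle_edges_eq_pairs:
  assumes "a \<noteq> b" "b \<noteq> c" "a \<noteq> c"
  shows "{{a, b}, {b, c}, {a, c}} = {e. e \<subseteq> {a, b, c} \<and> card e = 2}"
proof
  show "{{a, b}, {b, c}, {a, c}} \<subseteq> {e. e \<subseteq> {a, b, c} \<and> card e = 2}" using assms by auto
  show "{e. e \<subseteq> {a, b, c} \<and> card e = 2} \<subseteq> {{a, b}, {b, c}, {a, c}}"
  proof
    fix e assume "e \<in> {e. e \<subseteq> {a, b, c} \<and> card e = 2}"
    then obtain x y where e: "e = {x, y}" "x \<noteq> y" "x \<in> {a, b, c}" "y \<in> {a, b, c}"
      by (auto simp: card_2_iff)
    from e(3) e(2,4) show "e \<in> {{a, b}, {b, c}, {a, c}}"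
      unfolding e(1) by (elim insertE emptyE) (simp_all add: insert_commute)
  qed
qed

lemma increasing_enumeration_three:
  fixes a b c :: "'a :: linorder"
  assumes "a \<noteq> b" "b \<noteq> c" "a \<noteq> c"
  shows "\<exists>i j k. {i, j, k} = {a, b, c} \<and> i < j \<and> j < k"
proof -
  consider "a < b" "b < c" | "a < c" "c < b" | "b < a" "a < c" | "b < c" "c < a" | "c < a" "a < b" | "c < b" "b < a"
    using assms by (auto simp: neq_iff)
  then show ?thesis
  proof cases
    case 1 then show ?thesis by (intro exI[of _ a] exI[of _ b] exI[of _ c]) auto
  next
    case 2 then show ?thesis by (intro exI[of _ a] exI[of _ c] exI[of _ b]) auto
  next
    case 3 then show ?thesis by (intro exI[of _ b] exI[of _ a] exI[of _ c]) auto
  next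
    case 4 then show ?thesis by (intro exI[of _ b] exI[of _ c] exI[of _ a]) auto
  next
    case 5 then show ?thesis by (intro exI[of _ c] exI[of _ a] exI[of _ b]) auto
  next
    case 6 then show ?thesis by (intro exI[of _ c] exI[of _ b] exI[of _ a]) auto
  qed
qed

text \<open>
  Every triangle subgraph arises from the increasing enumeration of its vertices. The bound has
  this direction because the error terms decrease in the number of triples.
\<close>
lemma num_subgraphs_triangle_le:
  assumes G: "simple_graph G" and fin: "finite (C3 G)"
  shows "num_subgraphs G triangle_graph \<le> card (C3 G)"
proof -
  let ?f = "\<lambda>(i, j, k). ({i, j, k}, {{i, j}, {j, k}, {k, i}})"
  have "S \<in> ?f ` C3 G" if S: "is_subgraph S G" "graph_iso S triangle_graph" for S :: "nat graph"
  proof -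
    obtain f :: "nat \<Rightarrow> nat" where f: "bij_betw f (verts S) {1, 2, 3}" "{{1, 2}, {2, 3}, {1, 3}} = (\<lambda>e. f ` e) ` edges S"
      using S(2) unfolding graph_iso_def triangle_graph_def by auto
    have sub: "e \<subseteq> verts S" if "e \<in> edges S" for e
      using S(1) that by (auto simp: is_subgraph_def simple_graph_def)
    define g where "g = inv_into (verts S) f"
    have V: "verts S = {g 1, g 2, g 3}"
      using bij_betw_imp_surj_on[OF bij_betw_inv_into[OF f(1)]] by (auto simp: g_def)
    have inj: "inj_on g {1, 2, 3}"
      using bij_betw_inv_into[OF f(1)] by (auto simp: g_def bij_betw_def)
    have "edges S = (\<lambda>e. g ` e) ` (\<lambda>e. f ` e) ` edges S"
    proof -
      have "g ` f ` e = e" if "e \<in> edges S" for e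
        using sub[OF that] f(1) unfolding g_def bij_betw_def by (simp add: inv_into_image_cancel)
      then show ?thesis by (simp add: image_image)
    qed
    also have "\<dots> = {{g 1, g 2}, {g 2, g 3}, {g 1, g 3}}" unfolding f(2)[symmetric] by simp
    finally have E: "edges S = {{g 1, g 2}, {g 2, g 3}, {g 1, g 3}}" .
    have S_eq: "S = ({g 1, g 2, g 3}, {{g 1, g 2}, {g 2, g 3}, {g 1, g 3}})"
      using V E by (metis prod.collapse)
    have EG: "{g 1, g 2} \<in> edges G" "{g 2, g 3} \<in> edges G" "{g 1, g 3} \<in> edges G"
      using S(1) E by (auto simp: is_subgraph_def)
    have g_neq: "g 1 \<noteq> g 2" "g 2 \<noteq> g 3" "g 1 \<noteq> g 3" 
      using inj_on_eq_iff[OF inj, of 1 2] inj_on_eq_iff[OF inj, of 2 3] inj_on_eq_iff[OF inj, of 1 3] by simp_all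
    obtain i j k where ijk: "{i, j, k} = {g 1, g 2, g 3}" "i < j" "j < k"
      using increasing_enumeration_three[OF g_neq] by metis
    have m: "i \<in> {g 1, g 2, g 3}" "j \<in> {g 1, g 2, g 3}" "k \<in> {g 1, g 2, g 3}"
      using ijk(1) by blast+
    have pair: "{a, b} \<in> edges G" if "a \<in> {g 1, g 2, g 3}" "b \<in> {g 1, g 2, g 3}" "a \<noteq> b" for a b
      using that EG by (auto simp: insert_commute)
    have C: "(i, j, k) \<in> C3 G"
      using ijk(2,3) pair[OF m(1,2)] pair[OF m(2,3)] pair[OF m(3,1)] by (simp add: C3_def)
    have ki: "{k, i} = {i, k}" by blast
    have "{{i, j}, {j, k}, {i, k}} = {e. e \<subseteq> {i, j, k} \<and> card e = 2}"
      using ijk(2,3) by (intro triangle_edges_eq_pairs) auto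
    also have "\<dots> = {{g 1, g 2}, {g 2, g 3}, {g 1, g 3}}"
      unfolding ijk(1) by (rule triangle_edges_eq_pairs[OF g_neq, symmetric])
    finally have "?f (i, j, k) = S"
      unfolding S_eq prod.case ki ijk(1) by simp
    with imageI[OF C, of ?f] show ?thesis by simp
  qed
  then have "{S. is_subgraph S G \<and> graph_iso S triangle_graph} \<subseteq> ?f ` C3 G" by blast
  then have "num_subgraphs G triangle_graph \<le> card (?f ` C3 G)"
    unfolding num_subgraphs_def using fin by (intro card_mono) auto
  also have "\<dots> \<le> card (C3 G)" using fin by (rule card_image_le)
  finally show ?thesis .
qed

lemma C3_edges:
  assumes "(i, j, k) \<in> C3 G" "{x, y} \<subseteq> {i, j, k}" "x \<noteq> y"
  shows "{x, y} \<in> edges G"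
  using assms by (auto simp: C3_def insert_commute)

text \<open>
  Without isolated vertices, being a subgraph is a condition on the edges only.
\<close>
lemma is_subgraphI:
  assumes "simple_graph G" "V = \<Union>E" "E \<subseteq> edges G"
  shows "is_subgraph (V, E) G"
  using assms by (auto simp: is_subgraph_def simple_graph_def intro: finite_subset)

text \<open>
  The isomorphism asked for by \<open>graph_iso\<close> goes from the copy to the model, whereas copies are easier to
  give by naming the image of each model vertex.
\<close>
lemma graph_iso_by_enumeration:
  fixes g :: "'b \<Rightarrow> 'a"
  assumes "inj_on g V" "\<And>e. e \<in> E \<Longrightarrow> e \<subseteq> V"
  shows "graph_iso (g ` V, (\<lambda>e. g ` e) ` E) (V, E)"
proof -
  have "bij_betw (inv_into V g) (g ` V) V"
    using assms(1) by (intro bij_betw_inv_into) (auto simp: bij_betw_def)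
  moreover have "inv_into V g ` g ` e = e" if "e \<in> E" for e
    using assms that by (auto simp: inv_into_f_f subset_iff image_image)
  ultimately show ?thesis
    unfolding graph_iso_def by (intro exI[of _ "inv_into V g"]) (simp add: image_image)
qed

lemma graph_iso_card: "graph_iso S H \<Longrightarrow> card (verts S) = card (verts H)"
  by (auto simp: graph_iso_def intro: bij_betw_same_card)

text \<open>
  The witness is the union of the two triangles, whose shape is determined by the size of the intersection.
\<close>
lemma overlapping_pair_in_subgraph:
  assumes G: "simple_graph G" and C: "(i, j, k) \<in> C3 G" "(l, m, p) \<in> C3 G"
    and int: "card ({i, j, k} \<inter> {l, m, p}) \<in> {1, 2}"
  shows "\<exists>S. is_subgraph S G \<and> (graph_iso S triangles_edge \<or> graph_iso S triangles_vertex)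
    \<and> {i, j, k} \<union> {l, m, p} \<subseteq> verts S"
proof -
  have "i < j" "j < k" "l < m" "m < p" using C by (auto simp: C3_def)
  then have "card {i, j, k} = 3" "card {l, m, p} = 3" by auto
  then show ?thesis
  proof (cases rule: intersect_cases_three)
    case equal
    then show ?thesis using int \<open>card {i, j, k} = 3\<close> by simp
  next
    case disjoint
    then show ?thesis using int by simp
  next
    case (edge x y z w)
    \<comment> \<open>The common edge of the model joins the vertices 2 and 3.\<close>
    define g where "g = (\<lambda>a :: nat. if a = 1 then z else if a = 2 then x else if a = 3 then y else w)"
    let ?E = "{{1, 2}, {2, 3}, {1, 3}, {2, 4}, {3, 4}} :: nat set set"
    have "inj_on g {1, 2, 3, 4}" using edge(3) by (auto simp: inj_on_def g_def)
    then have "graph_iso (g ` {1, 2, 3, 4}, (\<lambda>e. g ` e) ` ?E) triangles_edge"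
      unfolding triangles_edge_def by (rule graph_iso_by_enumeration) auto
    also have "g ` {1, 2, 3, 4} = {z, x, y, w}" by (simp add: g_def insert_commute)
    also have "(\<lambda>e. g ` e) ` ?E = {{z, x}, {x, y}, {z, y}, {x, w}, {y, w}}" by (simp add: g_def insert_commute)
    finally have iso: "graph_iso ({z, x, y, w}, {{z, x}, {x, y}, {z, y}, {x, w}, {y, w}}) triangles_edge" .
    have sub: "is_subgraph ({z, x, y, w}, {{z, x}, {x, y}, {z, y}, {x, w}, {y, w}}) G"
    proof (rule is_subgraphI[OF G])
      have e1: "{a, b} \<in> edges G" if "{a, b} \<subseteq> {x, y, z}" "a \<noteq> b" for a b
        using C3_edges[OF C(1), of a b] that edge(1) by simp
      have e2: "{a, b} \<in> edges G" if "{a, b} \<subseteq> {x, y, w}" "a \<noteq> b" for a b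
        using C3_edges[OF C(2), of a b] that edge(2) by simp
      show "{{z, x}, {x, y}, {z, y}, {x, w}, {y, w}} \<subseteq> edges G"
        using e1[of z x] e1[of x y] e1[of z y] e2[of x w] e2[of y w] edge(3) by simp
    qed auto
    have "{i, j, k} \<union> {l, m, p} \<subseteq> verts ({z, x, y, w}, {{z, x}, {x, y}, {z, y}, {x, w}, {y, w}})"
      unfolding edge(1,2) by simp
    with iso sub show ?thesis by blast
  next
    case (vertex x y z u w)
    \<comment> \<open>The common vertex of the model is the vertex 1.\<close>
    define g where "g = (\<lambda>a :: nat. if a = 1 then x else if a = 2 then y else if a = 3 then z else if a = 4 then u else w)"
    let ?E = "{{1, 2}, {2, 3}, {1, 3}, {1, 4}, {4, 5}, {1, 5}} :: nat set set"
    have "inj_on g {1, 2, 3, 4, 5}" using vertex(3) by (auto simp: inj_on_def g_def)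
    then have "graph_iso (g ` {1, 2, 3, 4, 5}, (\<lambda>e. g ` e) ` ?E) triangles_vertex"
      unfolding triangles_vertex_def by (rule graph_iso_by_enumeration) auto
    also have "g ` {1, 2, 3, 4, 5} = {x, y, z, u, w}" by (simp add: g_def insert_commute)
    also have "(\<lambda>e. g ` e) ` ?E = {{x, y}, {y, z}, {x, z}, {x, u}, {u, w}, {x, w}}" by (simp add: g_def insert_commute)
    finally have iso: "graph_iso ({x, y, z, u, w}, {{x, y}, {y, z}, {x, z}, {x, u}, {u, w}, {x, w}}) triangles_vertex" .
    have sub: "is_subgraph ({x, y, z, u, w}, {{x, y}, {y, z}, {x, z}, {x, u}, {u, w}, {x, w}}) G"
    proof (rule is_subgraphI[OF G])
      have e1: "{a, b} \<in> edges G" if "{a, b} \<subseteq> {x, y, z}" "a \<noteq> b" for a b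
        using C3_edges[OF C(1), of a b] that vertex(1) by simp
      have e2: "{a, b} \<in> edges G" if "{a, b} \<subseteq> {x, u, w}" "a \<noteq> b" for a b
        using C3_edges[OF C(2), of a b] that vertex(2) by simp
      show "{{x, y}, {y, z}, {x, z}, {x, u}, {u, w}, {x, w}} \<subseteq> edges G"
        using e1[of x y] e1[of y z] e1[of x z] e2[of x u] e2[of u w] e2[of x w] vertex(3) by simp
    qed auto
    have "{i, j, k} \<union> {l, m, p} \<subseteq> verts ({x, y, z, u, w}, {{x, y}, {y, z}, {x, z}, {x, u}, {u, w}, {x, w}})"
      unfolding vertex(1,2) by simp
    with iso sub show ?thesis by blast
  qed
qed

text \<open>
  Every overlapping pair lives on the vertices of some copy of a model graph. A copy has at most 5
  vertices, hence carries at most $5^6 = 15625$ pairs of triples.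
\<close>
lemma card_overlapping_pairs_le:
  assumes G: "simple_graph G"
  shows "card (overlapping_pairs (C3 G))
    \<le> 15625 * (num_subgraphs G triangles_edge + num_subgraphs G triangles_vertex)"
proof -
  let ?\<S> = "{S. is_subgraph S G \<and> graph_iso S triangles_edge} \<union> {S. is_subgraph S G \<and> graph_iso S triangles_vertex}"
  let ?B = "\<lambda>S :: nat graph. (verts S \<times> verts S \<times> verts S) \<times> (verts S \<times> verts S \<times> verts S)"
  have fin: "finite ?\<S>" using finite_subgraphs[OF G, of triangles_edge] finite_subgraphs[OF G, of triangles_vertex] by simp
  have cover: "overlapping_pairs (C3 G) \<subseteq> (\<Union>S\<in>?\<S>. ?B S)"
  proof
    fix q assume q: "q \<in> overlapping_pairs (C3 G)"
    then obtain i j k l m p where eq: "q = ((i, j, k), (l, m, p))"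
      and C: "(i, j, k) \<in> C3 G" "(l, m, p) \<in> C3 G" "card ({i, j, k} \<inter> {l, m, p}) \<in> {1, 2}"
      unfolding overlapping_pairs_def by blast
    from overlapping_pair_in_subgraph[OF G C] obtain S where "S \<in> ?\<S>" "{i, j, k} \<union> {l, m, p} \<subseteq> verts S"
      by blast
    then show "q \<in> (\<Union>S\<in>?\<S>. ?B S)" unfolding eq by (intro UN_I[of S]) auto
  qed
  have size: "finite (?B S) \<and> card (?B S) \<le> 15625" if S: "S \<in> ?\<S>" for S
  proof -
    have fin_S: "finite (verts S)" using S by (auto simp: is_subgraph_def simple_graph_def)
    have "card (verts S) = card (verts triangles_edge) \<or> card (verts S) = card (verts triangles_vertex)"
      using S graph_iso_card[of S triangles_edge] graph_iso_card[of S triangles_vertex] by blast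
    then have "card (verts S) \<le> 5" by (auto simp: triangles_edge_def triangles_vertex_def)
    then have "card (verts S) ^ 6 \<le> 5 ^ 6" by (rule power_mono) simp
    moreover have "card (?B S) = card (verts S) ^ 6"
      by (simp only: card_cartesian_product) (simp add: eval_nat_numeral)
    ultimately show ?thesis using fin_S by simp
  qed
  have "card (overlapping_pairs (C3 G)) \<le> card (\<Union>S\<in>?\<S>. ?B S)"
    using cover fin size by (intro card_mono) auto
  also have "\<dots> \<le> (\<Sum>S\<in>?\<S>. card (?B S))" using fin by (rule card_UN_le)
  also have "\<dots> \<le> (\<Sum>S\<in>?\<S>. 15625)" using size by (intro sum_mono) blast
  also have "\<dots> = 15625 * card ?\<S>" by simp
  also have "card ?\<S> \<le> num_subgraphs G triangles_edge + num_subgraphs G triangles_vertex"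
    unfolding num_subgraphs_def by (rule card_Un_le)
  finally show ?thesis by simp
qed

section \<open>The asymptotic statement\<close>

text \<open>
  The quotient in \<open>much_less\<close> may be infinite where the smaller sequence vanishes; the inverted real quotient is
  zero there, so that it tends to 0 in every case.
\<close>
lemma much_less_imp:
  assumes "f \<lless> g" and f: "\<And>n. 0 \<le> f n" and g: "\<And>n. 0 \<le> g n"
  shows much_less_ratio_tendsto_0: "(\<lambda>n. f n / g n) \<longlonglongrightarrow> 0"
    and much_less_eventually_pos: "\<forall>\<^sub>F n in sequentially. 0 < g n"
proof -
  have lim: "(\<lambda>n. ereal (g n) / ereal (f n)) \<longlonglongrightarrow> \<infinity>" using assms(1) by (simp add: much_less_def)
  have large: "\<forall>\<^sub>F n in sequentially. ereal K < ereal (g n) / ereal (f n)" for K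
    using order_tendstoD(1)[OF lim, of "ereal K"] by simp
  show "\<forall>\<^sub>F n in sequentially. 0 < g n"
    using large[of 0]
  proof (rule eventually_mono)
    fix n assume "ereal 0 < ereal (g n) / ereal (f n)"
    then show "0 < g n" using g[of n] by (cases "g n = 0") (auto split: if_splits simp flip: zero_ereal_def)
  qed
  show "(\<lambda>n. f n / g n) \<longlonglongrightarrow> 0"
  proof (rule tendstoI)
    fix e :: real assume e: "0 < e"
    show "\<forall>\<^sub>F n in sequentially. dist (f n / g n) 0 < e"
      using large[of "1 / e"]
    proof (rule eventually_mono)
      fix n assume n: "ereal (1 / e) < ereal (g n) / ereal (f n)"
      show "dist (f n / g n) 0 < e"
      proof (cases "f n = 0")
        case True
        then show ?thesis using e by simp
      next
        case False
        then have "f n > 0" using f[of n] by simp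
        moreover from this have "1 / e < g n / f n" using n by simp
        moreover from calculation have "0 < g n" using e by (auto simp: field_simps) (smt (verit) mult_nonneg_nonpos zero_less_mult_iff)
        ultimately show ?thesis using e by (simp add: field_simps)
      qed
    qed
  qed
qed

theorem theorem3p1:
  fixes G :: "nat \<Rightarrow> nat graph" and d :: "nat \<Rightarrow> nat"
  assumes "\<And>n. simple_graph (G n)" and "\<And>n. verts (G n) = {1..n}"
    and "\<And>n. d n > 0"
    and "(\<lambda>n. real (d n)) \<lless> (\<lambda>n. real (num_subgraphs (G n) triangle_graph))"
    and "(\<lambda>n. real (num_subgraphs (G n) triangles_edge + num_subgraphs (G n) triangles_vertex))
           \<lless> (\<lambda>n. (real (num_subgraphs (G n) triangle_graph))\<^sup>2)"
  shows "(\<lambda>n. total_variation (kappa3_law (G n) (masked_wishart n (G n) (d n)))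
                               (kappa3_law (G n) (masked_goe n (G n)))) \<longlonglongrightarrow> 1
       \<and> (\<lambda>n. total_variation (masked_wishart n (G n) (d n)) (masked_goe n (G n))) \<longlonglongrightarrow> 1"
proof -
  let ?W = "\<lambda>n. masked_wishart n (G n) (d n)" and ?M = "\<lambda>n. masked_goe n (G n)"
  let ?\<kappa> = "\<lambda>n. total_variation (kappa3_law (G n) (?W n)) (kappa3_law (G n) (?M n))"
  define \<tau> where "\<tau> n = real (num_subgraphs (G n) triangle_graph)" for n
  define N where "N n = real (num_subgraphs (G n) triangles_edge + num_subgraphs (G n) triangles_vertex)" for n
  \<comment> \<open>The constant 562500 is 36 times 15625, from the number of pairs per copy.\<close>
  define L where "L n = 1 - (112 * (real (d n) / \<tau> n) + 562500 * (N n / (\<tau> n)\<^sup>2))" for n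
  have "(\<lambda>n. real (d n) / \<tau> n) \<longlonglongrightarrow> 0" and pos: "\<forall>\<^sub>F n in sequentially. 0 < \<tau> n"
    using much_less_imp[OF assms(4)] by (simp_all add: \<tau>_def)
  moreover have "(\<lambda>n. N n / (\<tau> n)\<^sup>2) \<longlonglongrightarrow> 0"
    using much_less_imp(1)[OF assms(5)] by (simp add: \<tau>_def N_def)
  ultimately have "L \<longlonglongrightarrow> 1 - (112 * 0 + 562500 * 0)"
    unfolding L_def by (intro tendsto_intros)
  then have L: "L \<longlonglongrightarrow> 1" by simp

  have lower: "\<forall>\<^sub>F n in sequentially. L n \<le> ?\<kappa> n"
    using pos
  proof (rule eventually_mono)
    fix n assume \<tau>: "0 < \<tau> n"
    note G = assms(1,2)[of n]
    let ?T = "real (card (C3 (G n)))" and ?P = "real (card (overlapping_pairs (C3 (G n))))"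
    have \<tau>_le: "\<tau> n \<le> ?T"
      unfolding \<tau>_def using num_subgraphs_triangle_le[OF G(1) finite_C3[OF G]] by simp
    have P_le: "?P \<le> 15625 * N n"
      unfolding N_def using of_nat_mono[OF card_overlapping_pairs_le[OF G(1)], where 'a = real] by simp
    have "real (d n) / ?T \<le> real (d n) / \<tau> n"
      using \<tau> \<tau>_le by (intro divide_left_mono) auto
    moreover have "?P / ?T\<^sup>2 \<le> 15625 * N n / (\<tau> n)\<^sup>2"
      using \<tau> \<tau>_le P_le by (intro frac_le power_mono) (auto simp: N_def)
    then have "?P / ?T\<^sup>2 \<le> 15625 * (N n / (\<tau> n)\<^sup>2)" by simp
    moreover have "C3 (G n) \<noteq> {}" using \<tau> \<tau>_le by auto
    note total_variation_kappa3_ge[OF G assms(3)[of n] this]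
    ultimately show "L n \<le> ?\<kappa> n" unfolding L_def by linarith
  qed

  have prob: "prob_space (?W n)" "prob_space (?M n)" for n
    by (rule prob_space_masked_wishart prob_space_masked_goe)+
  have sets_eq: "sets (?W n) = sets (?M n)" for n
    by (simp add: masked_wishart_def masked_goe_def masked_def)
  have meas: "kappa3 (G n) \<in> borel_measurable (?W n)" for n
    using kappa3_measurable[OF assms(1,2)] by (simp add: masked_wishart_def masked_def)
  have data: "?\<kappa> n \<le> total_variation (?W n) (?M n)" for n
    unfolding kappa3_law_def by (rule total_variation_distr_le[OF prob sets_eq meas])
  have upper: "total_variation (?W n) (?M n) \<le> 1" for n
    by (rule total_variation_le_1[OF prob])

  have statistic: "?\<kappa> \<longlonglongrightarrow> 1"
  proof (rule tendsto_sandwich[OF lower _ L tendsto_const])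
    show "\<forall>\<^sub>F n in sequentially. ?\<kappa> n \<le> 1"
      by (intro always_eventually allI order_trans[OF data upper])
  qed
  have "(\<lambda>n. total_variation (?W n) (?M n)) \<longlonglongrightarrow> 1"
    by (rule tendsto_sandwich[OF _ _ statistic tendsto_const])
      (intro always_eventually allI data upper)+
  with statistic show ?thesis by (rule conjI)
qed

end
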